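(* Let $G$ be a finite simple graph that is $K_{2,2,2}$-free and hole-edge-disjoint. Suppose that $S_{C,e}^{(G)}\neq\emptyset$ for every hole $C$ of $G$ and every edge $e\in E(C)$. Then $G$ has the chordal property. Consequently, $G$ has a chordal cut.
   Context: A hole is a chordless cycle of length at least $4$. $G$ is hole-edge-disjoint if its holes are pairwise edge-disjoint; $G$ is $K_{2,2,2}$-free if it has no induced subgraph isomorphic to $K_{2,2,2}$. For a hole $C$, let $X_C=\{v\in V(G): uv\in E(G)\text{ for all }u\in V(C)\}$. A path $W$ is $C$-avoiding if (1) none of its internal vertices lies in $V(C)\cup X_C$, and (2) if $W$ has length $1$, at least one of its two vertices is not in $V(C)\cup X_C$. For an edge $e=uv$ of $C$, let $\mathcal{P}_{C,uv}$ be the set of $C$-avoiding $(u,v)$-paths, $X_{C,e}=X_C\cup\{u,v\}$, $S_{C,e}^{(G)}=\bigcup_{P\in\mathcal{P}_{C,uv}}V(P)\setminus\{u,v\}$, $T_{C,e}=\{w: uwv\in\mathcal{P}_{C,uv}\}$. Let $Q_{C,e}$ be the connected component of $G-X_{C,e}$ containing $V(C)\setminus\{u,v\}$, and $U_{C,e}$ the union of those connected components of $G-X_{C,e}-Q_{C,e}$ that contain a vertex of $T_{C,e}$. $G$ has the chordal property if there exist a hole $C$ and $e\in E(C)$ such that $G[V(U_{C,e})\cup X_{C,e}]$ is chordal. A clique cut is a set $X\subseteq V(G)$ with $G[X]$ complete such that $G-X$ has more connected components than $G$; a clique cut $X$ is a chordal cut if there is a union $U$ of connected components of $G-X$ such that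 $G[U\cup X]$ is chordal.
   Formalization: The formal theorem additionally assumes that G has at least one hole; for hole-free G (e.g. K_1) the hypothesis on S_{C,e} is vacuous and the chordal property, which asserts a hole, fails. *)

theory Defs
  imports "Graph_Theory.Graph_Theory"
begin

text \<open>
  Finite simple graphs are the library's \<^const>\<open>graph\<close>s: finite, symmetric, loop-free digraphs
  without parallel arcs, each undirected edge being a pair of opposite arcs. Consequently two
  subgraphs are edge-disjoint iff they are arc-disjoint, and connected components are strongly
  connected components. Components are represented by their vertex sets.
\<close>

abbreviation components :: "('a,'b) pre_digraph \<Rightarrow> 'a set set" where
  "components G \<equiv> pre_digraph.sccs_verts G"

definition del_verts :: "('a,'b) pre_digraph \<Rightarrow> 'a set \<Rightarrow> ('a,'b) pre_digraph" where
  "del_verts G X = G \<restriction> (verts G - X)"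

definition complete_tripartite_digraph :: "nat \<Rightarrow> nat \<Rightarrow> nat \<Rightarrow> ('a,'b) pre_digraph \<Rightarrow> bool" where
  "complete_tripartite_digraph l m n H \<longleftrightarrow> graph H \<and>
    (\<exists>A B D. verts H = A \<union> B \<union> D \<and> A \<inter> B = {} \<and> A \<inter> D = {} \<and> B \<inter> D = {} \<and>
      card A = l \<and> card B = m \<and> card D = n \<and>
      arcs_ends H = A \<times> B \<union> B \<times> A \<union> A \<times> D \<union> D \<times> A \<union> B \<times> D \<union> D \<times> B)"

definition K222_free :: "('a,'b) pre_digraph \<Rightarrow> bool" where
  "K222_free G \<longleftrightarrow> \<not> (\<exists>H. induced_subgraph H G \<and> complete_tripartite_digraph 2 2 2 H)"

text \<open>
  The length bound excludes the closed walks \<open>a, b, a\<close>, which are cycles in the sense of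
  \<^const>\<open>pre_digraph.cycle\<close>.
\<close>

definition cycle_graph :: "('a,'b) pre_digraph \<Rightarrow> bool" where
  "cycle_graph C \<longleftrightarrow> (\<exists>p. pre_digraph.cycle C p \<and> 3 \<le> length p \<and>
     verts C = tail C ` set p \<and>
     arcs_ends C = arc_to_ends C ` set p \<union> (arc_to_ends C ` set p)\<inverse>)"

definition chordless :: "('a,'b) pre_digraph \<Rightarrow> ('a,'b) pre_digraph \<Rightarrow> bool" where
  "chordless G C \<longleftrightarrow> \<not> (\<exists>x\<in>verts C. \<exists>y\<in>verts C. x \<rightarrow>\<^bsub>G\<^esub> y \<and> \<not> x \<rightarrow>\<^bsub>C\<^esub> y)"

definition is_hole :: "('a,'b) pre_digraph \<Rightarrow> ('a,'b) pre_digraph \<Rightarrow> bool" where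
  "is_hole G C \<longleftrightarrow> subgraph C G \<and> cycle_graph C \<and> chordless G C \<and> 4 \<le> card (verts C)"

definition hole_edge_disjoint :: "('a,'b) pre_digraph \<Rightarrow> bool" where
  "hole_edge_disjoint G \<longleftrightarrow>
    (\<forall>C D. is_hole G C \<longrightarrow> is_hole G D \<longrightarrow> C \<noteq> D \<longrightarrow> arcs C \<inter> arcs D = {})"

definition chordal :: "('a,'b) pre_digraph \<Rightarrow> bool" where
  "chordal G \<longleftrightarrow> \<not> (\<exists>C. is_hole G C)"

definition X_hole :: "('a,'b) pre_digraph \<Rightarrow> ('a,'b) pre_digraph \<Rightarrow> 'a set" where
  "X_hole G C = {v \<in> verts G. \<forall>u\<in>verts C. u \<rightarrow>\<^bsub>G\<^esub> v}"

text \<open>The internal vertices of a path \<open>W\<close>, given as a vertex list, are those of \<open>butlast (tl W)\<close>.\<close>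

definition avoiding :: "('a,'b) pre_digraph \<Rightarrow> ('a,'b) pre_digraph \<Rightarrow> 'a vwalk \<Rightarrow> bool" where
  "avoiding G C W \<longleftrightarrow>
    set (butlast (tl W)) \<inter> (verts C \<union> X_hole G C) = {} \<and>
    (vwalk_length W = 1 \<longrightarrow> (\<exists>w\<in>set W. w \<notin> verts C \<union> X_hole G C))"

text \<open>Below, an edge \<open>e = uv\<close> of a hole is given by its two endpoints.\<close>

definition P_edge :: "('a,'b) pre_digraph \<Rightarrow> ('a,'b) pre_digraph \<Rightarrow> 'a \<Rightarrow> 'a \<Rightarrow> 'a vwalk set" where
  "P_edge G C u v = {W. vpath W G \<and> hd W = u \<and> last W = v \<and> avoiding G C W}"

definition X_edge :: "('a,'b) pre_digraph \<Rightarrow> ('a,'b) pre_digraph \<Rightarrow> 'a \<Rightarrow> 'a \<Rightarrow> 'a set" where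
  "X_edge G C u v = X_hole G C \<union> {u, v}"

definition S_edge :: "('a,'b) pre_digraph \<Rightarrow> ('a,'b) pre_digraph \<Rightarrow> 'a \<Rightarrow> 'a \<Rightarrow> 'a set" where
  "S_edge G C u v = (\<Union>W\<in>P_edge G C u v. set W) - {u, v}"

definition T_edge :: "('a,'b) pre_digraph \<Rightarrow> ('a,'b) pre_digraph \<Rightarrow> 'a \<Rightarrow> 'a \<Rightarrow> 'a set" where
  "T_edge G C u v = {w. [u, w, v] \<in> P_edge G C u v}"

text \<open>
  The description below is proper when \<open>C\<close> is a hole: \<open>C\<close> without \<open>u\<close> and \<open>v\<close> is then a nonempty
  path disjoint from \<open>X_edge G C u v\<close>.
\<close>

definition Q_edge :: "('a,'b) pre_digraph \<Rightarrow> ('a,'b) pre_digraph \<Rightarrow> 'a \<Rightarrow> 'a \<Rightarrow> 'a set" where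
  "Q_edge G C u v =
    (THE K. K \<in> components (del_verts G (X_edge G C u v)) \<and> verts C - {u, v} \<subseteq> K)"

definition U_edge :: "('a,'b) pre_digraph \<Rightarrow> ('a,'b) pre_digraph \<Rightarrow> 'a \<Rightarrow> 'a \<Rightarrow> 'a set" where
  "U_edge G C u v =
    \<Union> {K \<in> components (del_verts (del_verts G (X_edge G C u v)) (Q_edge G C u v)).
         K \<inter> T_edge G C u v \<noteq> {}}"

definition chordal_property :: "('a,'b) pre_digraph \<Rightarrow> bool" where
  "chordal_property G \<longleftrightarrow>
    (\<exists>C u v. is_hole G C \<and> u \<rightarrow>\<^bsub>C\<^esub> v \<and> chordal (G \<restriction> (U_edge G C u v \<union> X_edge G C u v)))"

definition clique_cut :: "('a,'b) pre_digraph \<Rightarrow> 'a set \<Rightarrow> bool" where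
  "clique_cut G X \<longleftrightarrow> X \<subseteq> verts G \<and> complete_digraph (card X) (G \<restriction> X) \<and>
    card (components G) < card (components (del_verts G X))"

text \<open>The union must have at least one member, as otherwise every clique cut would be chordal.\<close>

definition chordal_cut :: "('a,'b) pre_digraph \<Rightarrow> 'a set \<Rightarrow> bool" where
  "chordal_cut G X \<longleftrightarrow> clique_cut G X \<and>
    (\<exists>\<K>. \<K> \<subseteq> components (del_verts G X) \<and> \<K> \<noteq> {} \<and> chordal (G \<restriction> (\<Union>\<K> \<union> X)))"

end

theory Submission
  imports Defs
begin

text \<open>
  Let \<open>xy\<close> be an edge of a hole \<open>C\<close>. A shortest path from \<open>x\<close> to \<open>y\<close> inside a connected set that contains
  no common neighbour of \<open>x\<close> and \<open>y\<close> closes up to a hole through \<open>xy\<close>; as holes are edge-disjoint, this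
  hole is \<open>C\<close>. Hence if a connected set \<open>K\<close> outside \<open>C \<union> X\<^sub>C\<close> had two nonadjacent neighbours on \<open>C\<close>,
  then every edge of \<open>C\<close> would have a common neighbour in \<open>K\<close>, which fails for a minimal such \<open>K\<close>.
  So the components of \<open>G - (C \<union> X\<^sub>C)\<close> attach to \<open>C\<close> in cliques, and those attached to \<open>{x, y}\<close> are
  components of \<open>G - X\<^bsub>C,xy\<^esub>\<close>, where \<open>X\<^bsub>C,xy\<^esub>\<close> is a clique by \<open>K\<^bsub>2,2,2\<^esub>\<close>-freeness.
  Finally choose \<open>(C, xy)\<close> with \<open>U\<^bsub>C,xy\<^esub>\<close> of least size: a hole \<open>D\<close> in \<open>G[U\<^bsub>C,xy\<^esub> \<union> X\<^bsub>C,xy\<^esub>]\<close> would have an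
  edge \<open>f\<close> such that no component of \<open>U\<^bsub>D,f\<^esub>\<close> meets the clique \<open>X\<^bsub>C,xy\<^esub>\<close>, so that
  \<open>U\<^bsub>D,f\<^esub> \<subset> U\<^bsub>C,xy\<^esub>\<close>.
\<close>

unbundle no funcset_syntax

section \<open>Cyclic sequences of holes\<close>

text \<open>Lists the vertices of a hole in cyclic order. One equivalence both demands the cycle
  edges and forbids chords, so the hole is the subgraph induced on \<open>set d\<close>.\<close>

definition (in pre_digraph) hole_seq :: "'a list \<Rightarrow> bool" where
  "hole_seq d \<longleftrightarrow> distinct d \<and> 4 \<le> length d \<and>
    (\<forall>i<length d. \<forall>j<length d.
      d ! i \<rightarrow> d ! j \<longleftrightarrow> j = Suc i mod length d \<or> i = Suc j mod length d)"

lemma cyclic_neighbours_iff: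
  assumes "i < j" "j < m" "4 \<le> (m::nat)"
  shows "j = Suc i mod m \<or> i = Suc j mod m \<longleftrightarrow> j = Suc i \<or> i = 0 \<and> Suc j = m"
proof (cases "Suc j = m")
  case True
  then show ?thesis using assms by auto
next
  case False
  then have "Suc j mod m = Suc j" "Suc i mod m = Suc i" using assms by auto
  then show ?thesis using assms by auto
qed

section \<open>Adjacency and connectivity inside a vertex set\<close>

context graph
begin

lemma dominates_commute: "a \<rightarrow> b \<longleftrightarrow> b \<rightarrow> a"
  using graph_symmetric by blast

lemma not_dominates_self: "\<not> a \<rightarrow> a"
  using adj_not_same by blast

text \<open>Connectivity relative to a vertex set of the fixed graph \<open>G\<close>, in place of
  reachability in \<open>G \<restriction> S\<close>: changing \<open>S\<close> then needs no change
  of graph.\<close>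

definition reach :: "'a set \<Rightarrow> 'a \<Rightarrow> 'a \<Rightarrow> bool" where
  "reach S a b \<longleftrightarrow> (a, b) \<in> rtrancl_on S (arcs_ends G)"

lemma reach_refl: "a \<in> S \<Longrightarrow> reach S a a"
  by (simp add: reach_def)

lemma reach_adj: "a \<in> S \<Longrightarrow> b \<in> S \<Longrightarrow> a \<rightarrow> b \<Longrightarrow> reach S a b"
  unfolding reach_def by (metis rtrancl_on.simps)

lemma reach_trans: "reach S a b \<Longrightarrow> reach S b c \<Longrightarrow> reach S a c"
  unfolding reach_def by (rule rtrancl_on_trans)

lemma reach_step: "reach S a b \<Longrightarrow> b \<rightarrow> c \<Longrightarrow> c \<in> S \<Longrightarrow> reach S a c"
  unfolding reach_def by (rule rtrancl_on_into_rtrancl_on)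

lemma reach_sym: "reach S a b \<Longrightarrow> reach S b a"
  using sym_arcs rtrancl_on_sym[of "arcs_ends G" S] unfolding reach_def symmetric_def
  by (blast dest: symD)

lemma reach_mem: "reach S a b \<Longrightarrow> a \<in> S \<and> b \<in> S"
  unfolding reach_def by (blast dest: in_rtrancl_on_in_F)

lemma reach_induct [consumes 1, case_names base step]:
  assumes "reach S a b" "a \<in> S \<Longrightarrow> P a"
    "\<And>y z. reach S a y \<Longrightarrow> y \<rightarrow> z \<Longrightarrow> z \<in> S \<Longrightarrow> P y \<Longrightarrow> P z"
  shows "P b"
  using assms unfolding reach_def by (induct rule: rtrancl_on_induct) auto

lemma reach_mono: "reach S a b \<Longrightarrow> S \<subseteq> T \<Longrightarrow> reach T a b"
proof (induct rule: reach_induct)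
  case base
  then show ?case by (auto intro: reach_refl)
next
  case (step y z)
  then show ?case by (auto intro: reach_step)
qed

lemma reach_closed:
  assumes "reach S a b" "a \<in> K" "\<And>y z. y \<in> K \<Longrightarrow> y \<rightarrow> z \<Longrightarrow> z \<in> S \<Longrightarrow> z \<in> K"
  shows "b \<in> K"
  using assms by (induct rule: reach_induct) auto

lemma walk_reach:
  assumes "successively (dominates G) p" "a \<in> set p" "b \<in> set p"
  shows "reach (set p) a b"
proof -
  have "reach (set p) (hd p) b" if "successively (dominates G) p" "b \<in> set p" for b p
    using that
  proof (induct p)
    case (Cons c p)
    show ?case
    proof (cases "b = c")
      case True
      then show ?thesis by (auto intro: reach_refl)
    next
      case False
      with Cons have "p \<noteq> []" "reach (set p) (hd p) b" by (auto simp: successively_Cons)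
      moreover from this have "c \<rightarrow> hd p" using Cons.prems by (auto simp: successively_Cons)
      ultimately have "reach (set (c # p)) c (hd p)" "reach (set (c # p)) (hd p) b"
        by (auto intro: reach_adj reach_mono)
      then show ?thesis by (auto intro: reach_trans)
    qed
  qed simp
  then show ?thesis using assms by (blast intro: reach_trans reach_sym)
qed

lemma reach_walk:
  assumes "reach S a b"
  obtains p where "p \<noteq> []" "hd p = a" "last p = b" "set p \<subseteq> S" "successively (dominates G) p"
proof -
  from assms have "\<exists>p. p \<noteq> [] \<and> hd p = a \<and> last p = b \<and> set p \<subseteq> S \<and> successively (dominates G) p"
  proof (induct rule: reach_induct)
    case base
    then show ?case by (intro exI[of _ "[a]"]) auto
  next
    case (step y z)
    then obtain p where "p \<noteq> []" "hd p = a" "last p = y" "set p \<subseteq> S" "successively (dominates G) p"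
      by blast
    with step show ?case by (intro exI[of _ "p @ [z]"]) (auto simp: successively_append_iff)
  qed
  with that show thesis by blast
qed

section \<open>Index rules, rotation and reversal of hole sequences\<close>

lemma hole_seqD:
  assumes "hole_seq d" "i < j" "j < length d"
  shows "d ! i \<rightarrow> d ! j \<longleftrightarrow> j = Suc i \<or> i = 0 \<and> Suc j = length d"
proof -
  have "d ! i \<rightarrow> d ! j \<longleftrightarrow> j = Suc i mod length d \<or> i = Suc j mod length d"
    using assms unfolding hole_seq_def by auto
  with cyclic_neighbours_iff[OF assms(2,3)] assms(1) show ?thesis
    unfolding hole_seq_def by simp
qed

lemma hole_seqI:
  assumes "distinct d" "4 \<le> length d"
    "\<And>i j. i < j \<Longrightarrow> j < length d \<Longrightarrow> d ! i \<rightarrow> d ! j \<longleftrightarrow> j = Suc i \<or> i = 0 \<and> Suc j = length d"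
  shows "hole_seq d"
  unfolding hole_seq_def
proof (intro conjI allI impI)
  fix i j assume ij: "i < length d" "j < length d"
  consider "i < j" | "j < i" | "i = j" by linarith
  then show "d ! i \<rightarrow> d ! j \<longleftrightarrow> j = Suc i mod length d \<or> i = Suc j mod length d"
  proof cases
    case 1
    then show ?thesis using cyclic_neighbours_iff[OF 1 ij(2)] assms ij by auto
  next
    case 2
    then show ?thesis
      using cyclic_neighbours_iff[OF 2 ij(1)] assms(2) assms(3)[OF 2 ij(1)] dominates_commute by metis
  next
    case 3
    have "Suc i mod length d \<noteq> i" using ij assms(2) by (cases "Suc i = length d") auto
    then show ?thesis using 3 not_dominates_self by auto
  qed
qed (use assms in auto)

lemma hole_seq_rotate:
  assumes "hole_seq d"
  shows "hole_seq (rotate k d)"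
  unfolding hole_seq_def
proof (intro conjI allI impI)
  let ?m = "length d"
  fix i j assume ij: "i < length (rotate k d)" "j < length (rotate k d)"
  have m: "4 \<le> ?m" using assms by (simp add: hole_seq_def)
  have shift: "(k + b) mod ?m = Suc ((k + a) mod ?m) mod ?m \<longleftrightarrow> b = Suc a mod ?m" if "b < ?m" for a b
  proof -
    have "Suc ((k + a) mod ?m) mod ?m = (k + Suc a mod ?m) mod ?m"
      by (simp add: mod_Suc_eq mod_add_right_eq)
    \<comment> \<open>Adding \<open>k * (length d - 1)\<close> undoes the shift by \<open>k\<close>
      modulo \<open>length d\<close>, so the shift is injective on residues.\<close>
    moreover have "(k * (?m - 1) + (k + c) mod ?m) mod ?m = c mod ?m" for c
    proof -
      have "k * (?m - 1) + (k + c) = k * ?m + c" using m by (cases ?m) auto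
      then show ?thesis by (metis mod_add_right_eq mod_mult_self3)
    qed
    then have "b mod ?m = c mod ?m" if "(k + b) mod ?m = (k + c) mod ?m" for c
      using that by metis
    ultimately show ?thesis using that by (metis mod_less mod_mod_trivial)
  qed
  have "(k + i) mod ?m < ?m" "(k + j) mod ?m < ?m" using m by (auto intro!: mod_less_divisor simp del: length_greater_0_conv)
  then show "rotate k d ! i \<rightarrow> rotate k d ! j \<longleftrightarrow>
      j = Suc i mod length (rotate k d) \<or> i = Suc j mod length (rotate k d)"
    using assms ij shift[of j i] shift[of i j] by (auto simp: nth_rotate hole_seq_def)
qed (use assms in \<open>auto simp: hole_seq_def\<close>)

lemma hole_seq_rev:
  assumes "hole_seq d"
  shows "hole_seq (rev d)"
proof (rule hole_seqI)
  fix i j assume "i < j" "j < length (rev d)"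
  then show "rev d ! i \<rightarrow> rev d ! j \<longleftrightarrow> j = Suc i \<or> i = 0 \<and> Suc j = length (rev d)"
    using hole_seqD[OF assms, of "length d - Suc j" "length d - Suc i"] dominates_commute
    by (auto simp: rev_nth)
qed (use assms in \<open>auto simp: hole_seq_def\<close>)

text \<open>Rotation, and reversal if needed, turns any edge into the closing edge between last and
  first vertex; the rest of the hole is then the segment in between.\<close>

lemma hole_seq_edge:
  assumes "hole_seq d" "x \<in> set d" "y \<in> set d" "x \<rightarrow> y"
  obtains d' where "hole_seq d'" "set d' = set d" "hd d' = x" "last d' = y"
proof -
  have *: "\<exists>d'. hole_seq d' \<and> set d' = set d \<and> hd d' = y \<and> last d' = x"
    if "i < length d" "x = d ! i" "y = d ! (Suc i mod length d)" for i x y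
  proof (intro exI conjI)
    have m: "4 \<le> length d" "d \<noteq> []" using assms(1) by (auto simp: hole_seq_def)
    show "hole_seq (rotate (Suc i) d)" using assms(1) by (rule hole_seq_rotate)
    show "set (rotate (Suc i) d) = set d" by simp
    show "hd (rotate (Suc i) d) = y"
      using that m by (simp add: hd_rotate_conv_nth del: rotate_Suc)
    have "last (rotate (Suc i) d) = rotate (Suc i) d ! (length d - 1)"
      using m by (subst last_conv_nth) (auto simp del: rotate_Suc)
    also have "\<dots> = d ! ((Suc i + (length d - 1)) mod length d)"
      using m by (subst nth_rotate) auto
    also have "Suc i + (length d - 1) = i + length d" using m by auto
    finally show "last (rotate (Suc i) d) = x" using that by simp
  qed
  from assms obtain i j where ij: "i < length d" "j < length d" "x = d ! i" "y = d ! j"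
    by (metis in_set_conv_nth)
  with assms consider "i = Suc j mod length d" | "j = Suc i mod length d"
    unfolding hole_seq_def by blast
  then show thesis
  proof cases
    case 1
    with *[of j y x] ij that show ?thesis by blast
  next
    case 2
    with *[of i x y] ij obtain d' where d': "hole_seq d'" "set d' = set d" "hd d' = y" "last d' = x" by blast
    then have "d' \<noteq> []" by (auto simp: hole_seq_def)
    with d' hole_seq_rev[OF d'(1)] that[of "rev d'"] show ?thesis by (simp add: hd_rev last_rev)
  qed
qed

end

section \<open>Translation between hole subgraphs and hole sequences\<close>

lemma cas_conv_nth:
  "pre_digraph.cas G u p v \<longleftrightarrow> (if p = [] then u = v else tail G (hd p) = u \<and> head G (last p) = v \<and>
    (\<forall>i. Suc i < length p \<longrightarrow> head G (p ! i) = tail G (p ! Suc i)))"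
proof (induct p arbitrary: u)
  case Nil
  then show ?case by (simp add: pre_digraph.cas.simps)
next
  case (Cons e p)
  have "(\<forall>i. Suc i < length (e # p) \<longrightarrow> head G ((e # p) ! i) = tail G ((e # p) ! Suc i)) \<longleftrightarrow>
      (p \<noteq> [] \<longrightarrow> head G e = tail G (hd p)) \<and>
      (\<forall>i. Suc i < length p \<longrightarrow> head G (p ! i) = tail G (p ! Suc i))"
    by (auto simp: nth_Cons hd_conv_nth split: nat.splits)
  then show ?case using Cons by (auto simp: pre_digraph.cas.simps)
qed

context graph
begin

lemma arcs_ends_induce: "arcs_ends (G \<restriction> S) = arcs_ends G \<inter> S \<times> S"
  by (auto simp: arcs_ends_conv)

lemma hole_seq_verts:
  assumes "hole_seq d"
  shows "set d \<subseteq> verts G"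
proof
  fix x assume "x \<in> set d"
  then obtain i where i: "i < length d" "x = d ! i" by (metis in_set_conv_nth)
  moreover from this have "Suc i mod length d < length d" by (intro mod_less_divisor) auto
  ultimately have "d ! i \<rightarrow> d ! (Suc i mod length d)" using assms by (auto simp: hole_seq_def)
  then show "x \<in> verts G" using i by (auto dest: adj_in_verts)
qed

text \<open>One arc of \<open>G\<close> is chosen from each vertex to its cyclic successor. In order
  these arcs form the cycle required by \<open>cycle_graph\<close>, and every adjacency within
  \<open>set d\<close> is one of them or its reverse.\<close>

lemma hole_seq_is_hole:
  assumes "hole_seq d"
  shows "is_hole G (G \<restriction> set d)"
proof -
  let ?H = "G \<restriction> set d" and ?m = "length d" and ?s = "\<lambda>i. Suc i mod length d"
  have m: "4 \<le> ?m" "d \<noteq> []" and dist: "distinct d" using assms by (auto simp: hole_seq_def)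
  have s: "?s i < ?m" for i using m by (intro mod_less_divisor) auto
  have "\<exists>e\<in>arcs G. tail G e = d ! i \<and> head G e = d ! ?s i" if "i < ?m" for i
  proof -
    have "d ! i \<rightarrow> d ! ?s i" using assms s that unfolding hole_seq_def by auto
    then show ?thesis by (auto simp: arcs_ends_conv)
  qed
  then obtain a where a: "\<And>i. i < ?m \<Longrightarrow> a i \<in> arcs G \<and> tail G (a i) = d ! i \<and> head G (a i) = d ! ?s i"
    by metis
  define p where "p = map a [0..<?m]"
  have p: "length p = ?m" "p \<noteq> []" "\<And>i. i < ?m \<Longrightarrow> p ! i = a i" using m by (auto simp: p_def)
  have tails: "map (tail G) p = d" using a by (auto simp: p_def intro: nth_equalityI)
  have ends: "tail G (hd p) = d ! 0" "head G (last p) = d ! 0"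
    using p a m by (auto simp: hd_conv_nth last_conv_nth)
  have "pre_digraph.cas ?H (d ! 0) p (d ! 0)"
    using p a ends by (auto simp: cas_conv_nth)
  moreover have "set p \<subseteq> arcs ?H" using a s by (auto simp: p_def)
  ultimately have "pre_digraph.awalk ?H (d ! 0) p (d ! 0)"
    using m by (auto simp: pre_digraph.awalk_def)
  moreover have "distinct (tl (pre_digraph.awalk_verts ?H (d ! 0) p))"
  proof -
    have "pre_digraph.awalk_verts ?H (d ! 0) p = d @ [d ! 0]"
      using p tails ends by (simp add: pre_digraph.awalk_verts_conv)
    then show ?thesis using dist m by (cases d) auto
  qed
  ultimately have "pre_digraph.cycle ?H p" using p unfolding pre_digraph.cycle_def by blast
  moreover have "set d = tail G ` set p" using tails by (metis list.set_map)
  moreover have "arcs_ends ?H = arc_to_ends ?H ` set p \<union> (arc_to_ends ?H ` set p)\<inverse>"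
  proof -
    have E: "arc_to_ends ?H ` set p = {(d ! i, d ! ?s i) | i. i < ?m}"
      using a by (auto simp: p_def arc_to_ends_def image_iff) (metis atLeastLessThan_iff zero_le)+
    show ?thesis
    proof (intro set_eqI iffI)
      fix z assume "z \<in> arcs_ends ?H"
      then obtain i j where "z = (d ! i, d ! j)" "i < ?m" "j < ?m" "d ! i \<rightarrow> d ! j"
        unfolding arcs_ends_induce by (auto simp: in_set_conv_nth)
      then show "z \<in> arc_to_ends ?H ` set p \<union> (arc_to_ends ?H ` set p)\<inverse>"
        using assms unfolding E hole_seq_def by auto
    next
      fix z assume "z \<in> arc_to_ends ?H ` set p \<union> (arc_to_ends ?H ` set p)\<inverse>"
      then obtain i where "i < ?m" "z = (d ! i, d ! ?s i) \<or> z = (d ! ?s i, d ! i)"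
        unfolding E by auto
      then show "z \<in> arcs_ends ?H"
        using assms s[of i] unfolding arcs_ends_induce hole_seq_def by auto
    qed
  qed
  ultimately have "cycle_graph ?H" using p m unfolding cycle_graph_def
    by (intro exI[of _ p]) auto
  moreover have "subgraph ?H G" using hole_seq_verts[OF assms] by (auto intro: induced_imp_subgraph)
  moreover have "chordless G ?H" by (auto simp: chordless_def arcs_ends_induce)
  ultimately show ?thesis using m dist by (simp add: is_hole_def distinct_card)
qed

text \<open>The tails of the arcs of the cycle give the sequence. Chordlessness makes adjacency in
  \<open>C\<close> and in \<open>G\<close> agree on \<open>verts C\<close>, and the absence of
  parallel arcs turns this into equality of \<open>C\<close> with the induced subgraph.\<close>

lemma is_hole_obtain_seq:
  assumes "is_hole G C"
  obtains d where "hole_seq d" "C = G \<restriction> set d"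
proof -
  have sub: "subgraph C G" and chl: "chordless G C" and card: "4 \<le> card (verts C)"
    using assms by (auto simp: is_hole_def)
  then have comp: "tail C = tail G" "head C = head G" by (auto simp: subgraph_def compatible_def)
  from assms obtain p where cyc: "pre_digraph.cycle C p" and V: "verts C = tail C ` set p"
    and E: "arcs_ends C = arc_to_ends C ` set p \<union> (arc_to_ends C ` set p)\<inverse>"
    by (auto simp: is_hole_def cycle_graph_def)
  from cyc obtain u where u: "pre_digraph.awalk C u p u"
    and dist: "distinct (tl (pre_digraph.awalk_verts C u p))" and "p \<noteq> []"
    by (auto simp: pre_digraph.cycle_def)
  then have cas: "tail C (hd p) = u" "head C (last p) = u"
    "\<And>i. Suc i < length p \<Longrightarrow> head C (p ! i) = tail C (p ! Suc i)"
    by (auto simp: pre_digraph.awalk_def cas_conv_nth)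
  define d where "d = map (tail C) p"
  let ?m = "length d" and ?s = "\<lambda>i. Suc i mod length d"
  have "d \<noteq> []" "set d = verts C" using \<open>p \<noteq> []\<close> V by (auto simp: d_def)
  \<comment> \<open>The visited vertices are \<open>d\<close> followed by \<open>u\<close>, which is
    also the first entry of \<open>d\<close>; dropping that first entry leaves a permutation of
    \<open>d\<close>.\<close>
  have "distinct (tl (d @ [u]))"
    using dist \<open>p \<noteq> []\<close> cas by (simp add: pre_digraph.awalk_verts_conv d_def)
  moreover have "hd d = u" using cas \<open>p \<noteq> []\<close> by (simp add: d_def hd_map)
  ultimately have "distinct d" using \<open>d \<noteq> []\<close> by (cases d) auto
  with card \<open>set d = verts C\<close> have m: "4 \<le> ?m" by (metis distinct_card)
  have nth: "arc_to_ends C (p ! i) = (d ! i, d ! ?s i)" if "i < ?m" for i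
  proof (cases "Suc i = ?m")
    case True
    then show ?thesis using that cas \<open>hd d = u\<close> \<open>p \<noteq> []\<close> \<open>d \<noteq> []\<close>
      by (auto simp: arc_to_ends_def d_def last_conv_nth hd_conv_nth) (metis One_nat_def diff_Suc_1)
  next
    case False
    then show ?thesis using that cas(3)[of i] by (auto simp: arc_to_ends_def d_def)
  qed
  have dom: "x \<rightarrow>\<^bsub>C\<^esub> y \<longleftrightarrow> x \<rightarrow> y" if "x \<in> verts C" "y \<in> verts C" for x y
    using chl sub that by (auto simp: chordless_def arcs_ends_conv subgraph_def comp)
  have EC: "arcs_ends C = {(d ! i, d ! ?s i) | i. i < ?m} \<union> {(d ! ?s i, d ! i) | i. i < ?m}"
  proof -
    have "arc_to_ends C ` set p = {(d ! i, d ! ?s i) | i. i < ?m}"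
      using nth by (force simp: set_conv_nth d_def image_iff)
    then show ?thesis unfolding E by auto
  qed
  have "hole_seq d"
    unfolding hole_seq_def
  proof (intro conjI allI impI)
    fix i j assume ij: "i < ?m" "j < ?m"
    have s: "?s k < ?m" for k using m by (intro mod_less_divisor) auto
    have "d ! i \<rightarrow> d ! j \<longleftrightarrow> d ! i \<rightarrow>\<^bsub>C\<^esub> d ! j"
      using dom ij \<open>set d = verts C\<close> nth_mem by blast
    also have "\<dots> \<longleftrightarrow> j = ?s i \<or> i = ?s j"
      using ij s \<open>distinct d\<close> unfolding EC by (auto simp: nth_eq_iff_index_eq)
    finally show "d ! i \<rightarrow> d ! j \<longleftrightarrow> j = ?s i \<or> i = ?s j" .
  qed (use \<open>distinct d\<close> m in auto)
  moreover have "C = G \<restriction> set d"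
  proof -
    have "arcs C = arcs (G \<restriction> set d)"
    proof (intro set_eqI iffI)
      fix e assume "e \<in> arcs C"
      then show "e \<in> arcs (G \<restriction> set d)"
        using sub \<open>set d = verts C\<close> comp by (auto simp: subgraph_def wf_digraph_def)
    next
      fix e assume e: "e \<in> arcs (G \<restriction> set d)"
      then have "tail G e \<rightarrow> head G e" by (auto simp: arcs_ends_conv)
      with e dom \<open>set d = verts C\<close> have "tail G e \<rightarrow>\<^bsub>C\<^esub> head G e" by auto
      then obtain e' where e': "e' \<in> arcs C" "tail G e = tail G e'" "head G e = head G e'"
        by (auto simp: arcs_ends_conv comp)
      with e sub have "e = e'" by (intro no_multi_arcs) (auto simp: subgraph_def arc_to_ends_def)
      with e' show "e \<in> arcs C" by simp
    qed
    then show ?thesis using comp \<open>set d = verts C\<close> by (intro pre_digraph.equality) auto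
  qed
  ultimately show thesis by (rule that)
qed

text \<open>Different vertex sets give different holes, yet both induced subgraphs would contain the
  arc from \<open>x\<close> to \<open>y\<close>.\<close>

lemma hole_seq_unique:
  assumes "hole_edge_disjoint G" "hole_seq d" "hole_seq d'" "x \<rightarrow> y"
    "{x, y} \<subseteq> set d" "{x, y} \<subseteq> set d'"
  shows "set d = set d'"
proof (rule ccontr)
  assume "set d \<noteq> set d'"
  then have "G \<restriction> set d \<noteq> G \<restriction> set d'" by (metis induce_subgraph_verts)
  then have "arcs (G \<restriction> set d) \<inter> arcs (G \<restriction> set d') = {}"
    using assms hole_seq_is_hole unfolding hole_edge_disjoint_def by blast
  moreover obtain e where "e \<in> arcs G" "tail G e = x" "head G e = y"
    using \<open>x \<rightarrow> y\<close> by (auto simp: arcs_ends_conv)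
  ultimately show False using assms by auto
qed

end

section \<open>Detours around an edge of a hole\<close>

locale hed_graph = graph +
  assumes K222_free: "K222_free G" and hole_edge_disjoint: "hole_edge_disjoint G"

context graph
begin

lemma graph_induce:
  assumes "S \<subseteq> verts G"
  shows "graph (G \<restriction> S)"
proof -
  have "symmetric (G \<restriction> S)"
    using sym_arcs induced_induce[OF assms] by (rule induced_graph_imp_symmetric)
  moreover have "finite S" using assms finite_verts by (rule finite_subset)
  ultimately show ?thesis
    by unfold_locales (auto simp: no_loops arc_to_ends_def intro: no_multi_arcs)
qed

text \<open>With \<open>ab\<close> as closing edge, \<open>c\<close> is adjacent to both ends and so
  is at once second and second to last, which forces length 3.\<close>

lemma hole_seq_no_triangle:
  assumes "hole_seq d" "a \<in> set d" "b \<in> set d" "c \<in> set d" "a \<rightarrow> b" "b \<rightarrow> c" "a \<rightarrow> c"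
  shows False
proof -
  obtain f where f: "hole_seq f" "set f = set d" "hd f = a" "last f = b"
    using hole_seq_edge assms by metis
  then have m: "4 \<le> length f" "f \<noteq> []" by (auto simp: hole_seq_def)
  with f have ends: "f ! 0 = a" "f ! (length f - 1) = b" by (auto simp: hd_conv_nth last_conv_nth)
  obtain k where k: "k < length f" "f ! k = c" using f assms by (metis in_set_conv_nth)
  have "k \<noteq> 0" "k \<noteq> length f - 1" using ends k assms not_dominates_self by metis+
  then have "k = Suc 0" "length f - 1 = Suc k"
    using hole_seqD[OF f(1), of 0 k] hole_seqD[OF f(1), of k "length f - 1"] k ends m assms
      dominates_commute by auto
  then show False using m by simp
qed

lemma hole_seq_segment_reach:
  assumes "hole_seq d" "i \<le> j" "j < length d"
  shows "reach ((!) d ` {i..j}) (d ! i) (d ! j)"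
  using assms(2,3)
proof (induct j rule: dec_induct)
  case base
  then show ?case by (auto intro: reach_refl)
next
  case (step j)
  then have "reach ((!) d ` {i..Suc j}) (d ! i) (d ! j)" by (auto elim!: reach_mono)
  moreover have "d ! j \<rightarrow> d ! Suc j" using hole_seqD[OF assms(1), of j "Suc j"] step by simp
  ultimately show ?case using step by (auto intro: reach_step)
qed

lemma square_hole_seq:
  assumes "distinct [a, b, c, e]" "a \<rightarrow> b" "b \<rightarrow> c" "c \<rightarrow> e" "e \<rightarrow> a" "\<not> a \<rightarrow> c" "\<not> b \<rightarrow> e"
  shows "hole_seq [a, b, c, e]"
proof (rule hole_seqI)
  fix i j :: nat assume "i < j" "j < length [a, b, c, e]"
  then have "(i, j) \<in> {(0, 1), (0, 2), (0, 3), (1, 2), (1, 3), (2, 3)}" by auto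
  then show "[a, b, c, e] ! i \<rightarrow> [a, b, c, e] ! j \<longleftrightarrow> j = Suc i \<or> i = 0 \<and> Suc j = length [a, b, c, e]"
    using assms dominates_commute by (auto simp: numeral_eq_Suc)
qed (use assms in auto)

text \<open>Take a walk in \<open>W\<close> of least length among all those from some neighbour of
  \<open>x\<close> to some neighbour of \<open>y\<close>. Minimality excludes repetitions, chords
  and further edges to \<open>x\<close> or \<open>y\<close>; the lack of a common neighbour excludes
  a single vertex, so the closed sequence has length at least 4.\<close>

lemma shortest_detour_hole_seq:
  assumes "x \<rightarrow> y" "x \<notin> W" "y \<notin> W" "x \<rightarrow> x'" "y \<rightarrow> y'" "reach W x' y'"
    and no_common: "\<And>w. w \<in> W \<Longrightarrow> x \<rightarrow> w \<Longrightarrow> \<not> y \<rightarrow> w"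
  obtains p where "hole_seq (x # p @ [y])" "set p \<subseteq> W"
proof -
  define P where "P p \<longleftrightarrow> p \<noteq> [] \<and> set p \<subseteq> W \<and> successively (dominates G) p \<and> x \<rightarrow> hd p \<and> y \<rightarrow> last p" for p
  have "\<exists>p. P p" using reach_walk[OF assms(6)] assms unfolding P_def by metis
  then obtain p where p: "P p" and "\<And>q. P q \<Longrightarrow> length p \<le> length q"
    using ex_has_least_nat[of P _ length] by metis
  then have min: "\<not> P q" if "length q < length p" for q using that by fastforce
  have "p \<noteq> []" "set p \<subseteq> W" and succ: "successively (dominates G) p" "x \<rightarrow> hd p" "y \<rightarrow> last p"
    using p by (auto simp: P_def)
  have "distinct p"
  proof (rule ccontr)
    assume "\<not> distinct p"
    then obtain as z bs cs where p_eq: "p = as @ [z] @ bs @ [z] @ cs" using not_distinct_decomp by blast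
    then have "P (as @ [z] @ cs)"
      using p unfolding P_def
      by (auto simp: successively_append_iff successively_Cons hd_append split: if_splits)
    then show False using min p_eq by auto
  qed
  have "length p \<noteq> 1"
  proof
    assume "length p = 1"
    then obtain w where "p = [w]" by (auto simp: length_Suc_conv)
    then show False using p no_common by (auto simp: P_def)
  qed
  with \<open>p \<noteq> []\<close> have len: "2 \<le> length p" by (cases p rule: list.exhaust) (auto simp: Suc_le_eq)
  have step: "p ! i \<rightarrow> p ! Suc i" if "Suc i < length p" for i
    using succ that by (auto simp: successively_conv_nth)
  have chord: "\<not> p ! i \<rightarrow> p ! j" if "Suc i < j" "j < length p" for i j
  proof
    assume "p ! i \<rightarrow> p ! j"
    let ?q = "take (Suc i) p @ drop j p"
    have "successively (dominates G) (take (Suc i) p @ drop (Suc i) p)"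
         "successively (dominates G) (take j p @ drop j p)"
      using succ by auto
    then have "successively (dominates G) (take (Suc i) p)" "successively (dominates G) (drop j p)"
      unfolding successively_append_iff by blast+
    moreover have "last (take (Suc i) p) = p ! i" "hd (drop j p) = p ! j"
      using that by (auto simp: take_Suc_conv_app_nth hd_drop_conv_nth)
    ultimately have "successively (dominates G) ?q"
      using \<open>p ! i \<rightarrow> p ! j\<close> by (auto simp: successively_append_iff)
    moreover have "hd ?q = hd p" "last ?q = last p" "?q \<noteq> []" "set ?q \<subseteq> W"
      using that \<open>set p \<subseteq> W\<close> set_take_subset[of "Suc i" p] set_drop_subset[of j p]
      by (auto simp: hd_append hd_take last_drop)
    ultimately have "P ?q" using succ by (auto simp: P_def)
    then have "\<not> length ?q < length p" using min by blast
    then show False using that by auto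
  qed
  have x_adj: "x \<rightarrow> p ! j \<longleftrightarrow> j = 0" if "j < length p" for j
  proof
    assume adj: "x \<rightarrow> p ! j"
    \<comment> \<open>The walk may start at any neighbour of \<open>x\<close>, so a later neighbour
      \<open>p ! j\<close> would give the shorter walk \<open>drop j p\<close>.\<close>
    have "successively (dominates G) (take j p @ drop j p)" using succ by auto
    then have "successively (dominates G) (drop j p)" unfolding successively_append_iff by blast
    then have "P (drop j p)"
      using adj that succ \<open>set p \<subseteq> W\<close> set_drop_subset[of j p]
      by (auto simp: P_def hd_drop_conv_nth last_drop)
    then have "\<not> length (drop j p) < length p" using min by blast
    then show "j = 0" using that by auto
  next
    assume "j = 0"
    then show "x \<rightarrow> p ! j" using succ \<open>p \<noteq> []\<close> by (simp add: hd_conv_nth)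
  qed
  have y_adj: "p ! i \<rightarrow> y \<longleftrightarrow> Suc i = length p" if "i < length p" for i
  proof
    assume adj: "p ! i \<rightarrow> y"
    have "successively (dominates G) (take (Suc i) p @ drop (Suc i) p)" using succ by auto
    then have "successively (dominates G) (take (Suc i) p)" unfolding successively_append_iff by blast
    moreover have "last (take (Suc i) p) = p ! i" using that by (auto simp: take_Suc_conv_app_nth)
    ultimately have "P (take (Suc i) p)"
      using adj that succ \<open>set p \<subseteq> W\<close> set_take_subset[of "Suc i" p] dominates_commute
      by (auto simp: P_def hd_take)
    then have "\<not> length (take (Suc i) p) < length p" using min by blast
    then show "Suc i = length p" using that by auto
  next
    assume "Suc i = length p"
    then have "p ! i = last p" using \<open>p \<noteq> []\<close> by (metis diff_Suc_1 last_conv_nth)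
    then show "p ! i \<rightarrow> y" using succ dominates_commute by simp
  qed
  let ?d = "x # p @ [y]"
  have "hole_seq ?d"
  proof (rule hole_seqI)
    have "x \<noteq> y" using \<open>x \<rightarrow> y\<close> not_dominates_self by auto
    then show "distinct ?d" using \<open>distinct p\<close> \<open>set p \<subseteq> W\<close> assms by auto
    show "4 \<le> length ?d" using len by simp
    fix i j assume ij: "i < j" "j < length ?d"
    then obtain j' where j': "j = Suc j'" by (cases j) auto
    show "?d ! i \<rightarrow> ?d ! j \<longleftrightarrow> j = Suc i \<or> i = 0 \<and> Suc j = length ?d"
    proof (cases i)
      case 0
      show ?thesis
      proof (cases "j' < length p")
        case True
        then show ?thesis using x_adj[OF True] 0 j' by (auto simp: nth_append)
      next
        case False
        then show ?thesis using 0 j' ij \<open>x \<rightarrow> y\<close> by (auto simp: nth_append)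
      qed
    next
      case (Suc i')
      then have i': "i' < j'" "i' < length p" using ij j' by auto
      show ?thesis
      proof (cases "j' < length p")
        case True
        then show ?thesis using chord[of i' j'] step[of i'] i' Suc j' True
          by (cases "j' = Suc i'") (auto simp: nth_append)
      next
        case False
        then show ?thesis using y_adj[OF i'(2)] i' Suc j' ij by (auto simp: nth_append)
      qed
    qed
  qed
  then show thesis using that \<open>set p \<subseteq> W\<close> by blast
qed

text \<open>For a hole with vertex set \<open>S\<close> this is \<open>X_hole\<close>, expressed
  through vertices alone.\<close>

definition common_nbrs :: "'a set \<Rightarrow> 'a set" where
  "common_nbrs S = {v \<in> verts G. \<forall>u\<in>S. u \<rightarrow> v}"

lemma common_nbrs_disjoint: "v \<in> common_nbrs S \<Longrightarrow> v \<notin> S"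
  using not_dominates_self by (auto simp: common_nbrs_def)

end

context hed_graph
begin

text \<open>The detour closes up with \<open>xy\<close> to a hole, which edge-disjointness
  identifies with \<open>d\<close>. Used in contraposition: a detour set \<open>W\<close> missing
  some further vertex of \<open>d\<close> contains a common neighbour of \<open>x\<close> and
  \<open>y\<close>.\<close>

lemma detour_covers_hole:
  assumes "hole_seq d" "x \<in> set d" "y \<in> set d" "x \<rightarrow> y" "x \<notin> W" "y \<notin> W"
    "x \<rightarrow> x'" "y \<rightarrow> y'" "reach W x' y'"
    "\<And>w. w \<in> W \<Longrightarrow> x \<rightarrow> w \<Longrightarrow> \<not> y \<rightarrow> w"
  shows "set d \<subseteq> insert x (insert y W)"
proof -
  obtain p where p: "hole_seq (x # p @ [y])" "set p \<subseteq> W"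
    using shortest_detour_hole_seq[OF assms(4-10)] by blast
  have "set d = set (x # p @ [y])"
    using hole_edge_disjoint assms(1) p(1) assms(4) by (rule hole_seq_unique) (use assms in auto)
  then show ?thesis using p(2) by auto
qed

text \<open>The detour follows \<open>d\<close> from its second vertex to \<open>d ! i\<close>,
  crosses to \<open>d ! j\<close> along \<open>p\<close> and continues on \<open>d\<close> to the
  last but one. It misses \<open>d ! Suc i\<close>, hence does not cover the hole, so the ends of
  the closing edge have a common neighbour in \<open>W\<close>, and this lies on
  \<open>p\<close>.\<close>

lemma edge_common_nbr_in_walk_aux:
  assumes "hole_seq d" "successively (dominates G) p" "set p \<inter> set d = {}"
    and ij: "i < j" "j < length d" "\<not> d ! i \<rightarrow> d ! j"
    and "s \<in> set p" "t \<in> set p" "d ! i \<rightarrow> s" "d ! j \<rightarrow> t"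
  shows "\<exists>w\<in>set p. hd d \<rightarrow> w \<and> last d \<rightarrow> w"
proof (rule ccontr)
  assume none: "\<not> (\<exists>w\<in>set p. hd d \<rightarrow> w \<and> last d \<rightarrow> w)"
  define n where "n = length d - 1"
  have m: "4 \<le> length d" "distinct d" "d \<noteq> []" using assms(1) by (auto simp: hole_seq_def)
  then have n: "3 \<le> n" "length d = Suc n" by (auto simp: n_def)
  have ends: "hd d = d ! 0" "last d = d ! n"
    using m by (auto simp: hd_conv_nth last_conv_nth n_def)
  \<comment> \<open>Nonadjacency leaves a vertex strictly between \<open>i\<close> and
    \<open>j\<close> and keeps them from being the two ends.\<close>
  have gap: "Suc i < j" "\<not> (i = 0 \<and> j = n)" using hole_seqD[OF assms(1) ij(1,2)] ij n by auto
  \<comment> \<open>For \<open>i = 0\<close> or \<open>j = n\<close> the corresponding index range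
    is empty, and the detour starts or ends directly on \<open>p\<close>.\<close>
  define W where "W = set p \<union> (!) d ` {1..i} \<union> (!) d ` {j..n - 1}"
  have inj: "d ! k = d ! l \<longleftrightarrow> k = l" if "k \<le> n" "l \<le> n" for k l
    using that n m by (simp add: nth_eq_iff_index_eq)
  have in_p: "d ! k \<notin> set p" if "k \<le> n" for k using that n assms(3) by auto
  have st: "reach W s t"
    using walk_reach[OF assms(2) \<open>s \<in> set p\<close> \<open>t \<in> set p\<close>] by (rule reach_mono) (auto simp: W_def)
  have x': "\<exists>x'. hd d \<rightarrow> x' \<and> reach W x' s"
  proof (cases "i = 0")
    case True
    then show ?thesis using assms ends by (intro exI[of _ s]) (auto intro: reach_refl simp: W_def)
  next
    case False
    have "reach W (d ! 1) (d ! i)"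
      by (rule reach_mono[OF hole_seq_segment_reach[OF assms(1)]]) (use False ij in \<open>auto simp: W_def\<close>)
    then have "reach W (d ! 1) s" using assms by (auto intro: reach_step simp: W_def)
    moreover have "d ! 0 \<rightarrow> d ! 1" using hole_seqD[OF assms(1), of 0 1] n by simp
    ultimately show ?thesis using ends by auto
  qed
  have y': "\<exists>y'. last d \<rightarrow> y' \<and> reach W y' t"
  proof (cases "j = n")
    case True
    then show ?thesis using assms ends by (intro exI[of _ t]) (auto intro: reach_refl simp: W_def)
  next
    case False
    have "reach W (d ! j) (d ! (n - 1))"
      by (rule reach_mono[OF hole_seq_segment_reach[OF assms(1)]]) (use False ij n in \<open>auto simp: W_def\<close>)
    then have "reach W (d ! (n - 1)) t" using assms by (auto intro: reach_sym reach_step simp: W_def)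
    moreover have "d ! n \<rightarrow> d ! (n - 1)"
      using hole_seqD[OF assms(1), of "n - 1" n] n dominates_commute by simp
    ultimately show ?thesis using ends by auto
  qed
  from x' y' obtain x' y' where "hd d \<rightarrow> x'" "reach W x' s" "last d \<rightarrow> y'" "reach W y' t" by blast
  have "set d \<subseteq> insert (hd d) (insert (last d) W)"
  proof (rule detour_covers_hole[OF assms(1)])
    show "hd d \<rightarrow> last d" using hole_seqD[OF assms(1), of 0 n] n ends by simp
    show "hd d \<notin> W" "last d \<notin> W"
      unfolding W_def ends using inj in_p ij n gap by auto
    show "reach W x' y'" using \<open>reach W x' s\<close> st \<open>reach W y' t\<close> by (blast intro: reach_trans reach_sym)
    fix w assume "w \<in> W" "hd d \<rightarrow> w"
    show "\<not> last d \<rightarrow> w"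
    proof (cases "w \<in> set p")
      case True
      then show ?thesis using none \<open>hd d \<rightarrow> w\<close> by blast
    next
      case False
      \<comment> \<open>Of the inner vertices only \<open>d ! 1\<close> is adjacent to
        \<open>d ! 0\<close>, and it is not adjacent to \<open>d ! n\<close> because
        \<open>n\<close> is at least 3.\<close>
      then obtain k where k: "w = d ! k" "0 < k" "k < n"
        using \<open>w \<in> W\<close> ij n gap by (auto simp: W_def)
      with \<open>hd d \<rightarrow> w\<close> have "k = 1" using hole_seqD[OF assms(1), of 0 k] n ends by auto
      then have "\<not> d ! k \<rightarrow> d ! n" using hole_seqD[OF assms(1), of k n] n by auto
      then show ?thesis using k ends dominates_commute by auto
    qed
  qed (use m \<open>hd d \<rightarrow> x'\<close> \<open>last d \<rightarrow> y'\<close> in auto)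
  moreover have "d ! Suc i \<in> set d" using gap ij n by auto
  moreover have "d ! Suc i \<notin> insert (hd d) (insert (last d) W)"
    unfolding W_def ends using inj in_p ij n gap by auto
  ultimately show False by blast
qed

lemma edge_common_nbr_in_walk:
  assumes "hole_seq d" "successively (dominates G) p" "set p \<inter> set d = {}"
    and "a \<in> set d" "b \<in> set d" "a \<noteq> b" "\<not> a \<rightarrow> b"
    and "s \<in> set p" "t \<in> set p" "a \<rightarrow> s" "b \<rightarrow> t"
    and "x \<in> set d" "y \<in> set d" "x \<rightarrow> y"
  obtains w where "w \<in> set p" "x \<rightarrow> w" "y \<rightarrow> w"
proof -
  obtain f where f: "hole_seq f" "set f = set d" "hd f = x" "last f = y"
    using hole_seq_edge assms by metis
  obtain i j where ij: "i < length f" "j < length f" "a = f ! i" "b = f ! j"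
    using f assms by (metis in_set_conv_nth)
  consider "i < j" | "j < i" using ij assms by (metis nat_neq_iff)
  then have "\<exists>w\<in>set p. hd f \<rightarrow> w \<and> last f \<rightarrow> w"
  proof cases
    case 1
    then show ?thesis using edge_common_nbr_in_walk_aux[OF f(1) assms(2), of i j s t] assms f ij by auto
  next
    case 2
    then show ?thesis
      using edge_common_nbr_in_walk_aux[OF f(1) assms(2), of j i t s] assms f ij dominates_commute by auto
  qed
  with f that show thesis by blast
qed

text \<open>
  If two attachments were nonadjacent, three consecutive edges of the hole would have common neighbours
  on the walk. Two of these lie in the tail of the walk or both are its first vertex, so already this
  smaller walk has nonadjacent attachments.
\<close>

lemma walk_attachments_clique:
  assumes "hole_seq d" "successively (dominates G) p"
    and "set p \<inter> (set d \<union> common_nbrs (set d)) = {}"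
    and "a \<in> set d" "b \<in> set d" "s \<in> set p" "t \<in> set p" "a \<rightarrow> s" "b \<rightarrow> t"
  shows "a = b \<or> a \<rightarrow> b"
  using assms(2-)
proof (induct p arbitrary: a b s t)
  case Nil
  then show ?case by simp
next
  case (Cons c p)
  show ?case
  proof (rule ccontr)
    assume nonadj: "\<not> (a = b \<or> a \<rightarrow> b)"
    have common: "\<exists>w\<in>set (c # p). x \<rightarrow> w \<and> y \<rightarrow> w" if "x \<in> set d" "y \<in> set d" "x \<rightarrow> y" for x y
      using edge_common_nbr_in_walk[OF assms(1) Cons.prems(1), of a b s t x y] Cons.prems nonadj that
      by blast
    \<comment> \<open>For the one-vertex walk \<open>[c]\<close>, two nonadjacent neighbours on the
      hole would make \<open>c\<close> a common neighbour for every edge, hence adjacent to all of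
      \<open>d\<close>; but the walk avoids \<open>common_nbrs (set d)\<close>.\<close>
    have c: "x = y \<or> x \<rightarrow> y" if xy: "x \<in> set d" "y \<in> set d" "x \<rightarrow> c" "y \<rightarrow> c" for x y
    proof (rule ccontr)
      assume nonadj: "\<not> (x = y \<or> x \<rightarrow> y)"
      have "z \<rightarrow> c" if "z \<in> set d" for z
      proof -
        obtain i where i: "i < length d" "z = d ! i" using \<open>z \<in> set d\<close> by (metis in_set_conv_nth)
        then have s: "Suc i mod length d < length d" by (intro mod_less_divisor) auto
        then have "z \<rightarrow> d ! (Suc i mod length d)" using assms(1) i by (auto simp: hole_seq_def)
        moreover have "d ! (Suc i mod length d) \<in> set d" using s by (rule nth_mem)
        moreover have "set [c] \<inter> set d = {}" using Cons.prems(2) by auto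
        ultimately obtain w where "w \<in> set [c]" "z \<rightarrow> w"
          using edge_common_nbr_in_walk[OF assms(1), of "[c]" x y c c] xy nonadj \<open>z \<in> set d\<close>
          by (metis list.set_intros(1) successively.simps(2))
        then show ?thesis by simp
      qed
      moreover have "c \<in> verts G" using adj_in_verts(2) xy(3) by blast
      ultimately have "c \<in> common_nbrs (set d)" by (simp add: common_nbrs_def)
      then show False using Cons.prems by auto
    qed
    have p: "x = y \<or> x \<rightarrow> y"
      if "x \<in> set d" "y \<in> set d" "s \<in> set p" "t \<in> set p" "x \<rightarrow> s" "y \<rightarrow> t" for x y s t
    proof -
      have "successively (dominates G) p" using Cons.prems(1) by (auto simp: successively_Cons)
      moreover have "set p \<inter> (set d \<union> common_nbrs (set d)) = {}" using Cons.prems(2) by auto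
      ultimately show ?thesis using Cons.hyps that by blast
    qed
    have m: "4 \<le> length d" "distinct d" using assms(1) by (auto simp: hole_seq_def)
    have D: "d ! 0 \<in> set d" "d ! 1 \<in> set d" "d ! 2 \<in> set d" "d ! 3 \<in> set d"
      using m by (auto intro!: nth_mem)
    have inj: "d ! k = d ! l \<longleftrightarrow> k = l" if "k < 4" "l < 4" for k l
      using that m by (simp add: nth_eq_iff_index_eq)
    have E: "d ! 0 \<rightarrow> d ! 1" "d ! 1 \<rightarrow> d ! 2" "d ! 2 \<rightarrow> d ! 3"
      using hole_seqD[OF assms(1), of 0 1] hole_seqD[OF assms(1), of 1 2] hole_seqD[OF assms(1), of 2 3] m
      by auto
    \<comment> \<open>Any two of the three edges contain one of these nonadjacent pairs.\<close>
    have N: "\<not> (d ! 0 = d ! 2 \<or> d ! 0 \<rightarrow> d ! 2)" "\<not> (d ! 1 = d ! 3 \<or> d ! 1 \<rightarrow> d ! 3)"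
      using hole_seqD[OF assms(1), of 0 2] hole_seqD[OF assms(1), of 1 3] m inj[of 0 2] inj[of 1 3]
      by auto
    obtain t0 where t0: "t0 \<in> set (c # p)" "d ! 0 \<rightarrow> t0" "d ! 1 \<rightarrow> t0"
      using common E D by blast
    obtain t1 where t1: "t1 \<in> set (c # p)" "d ! 1 \<rightarrow> t1" "d ! 2 \<rightarrow> t1"
      using common E D by blast
    obtain t2 where t2: "t2 \<in> set (c # p)" "d ! 2 \<rightarrow> t2" "d ! 3 \<rightarrow> t2"
      using common E D by blast
    have "\<not> (t0 \<in> set p \<and> t1 \<in> set p)" "\<not> (t0 \<in> set p \<and> t2 \<in> set p)" "\<not> (t1 \<in> set p \<and> t2 \<in> set p)"
      using p[of "d ! 0" "d ! 2" t0 t1] p[of "d ! 0" "d ! 2" t0 t2] p[of "d ! 1" "d ! 3" t1 t2] N D t0 t1 t2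
      by blast+
    moreover have "\<not> (t0 = c \<and> t1 = c)" "\<not> (t0 = c \<and> t2 = c)" "\<not> (t1 = c \<and> t2 = c)"
      using c[of "d ! 0" "d ! 2"] c[of "d ! 1" "d ! 3"] N D t0 t1 t2 by blast+
    ultimately show False using t0(1) t1(1) t2(1) by auto
  qed
qed

section \<open>Cliqueness of the common neighbours of a hole\<close>

lemma no_octahedron:
  assumes "card A = 2" "card B = 2" "card D = 2" "A \<inter> B = {}" "A \<inter> D = {}" "B \<inter> D = {}"
    and adj: "A \<times> B \<subseteq> arcs_ends G" "A \<times> D \<subseteq> arcs_ends G" "B \<times> D \<subseteq> arcs_ends G"
    and nonadj: "A \<times> A \<inter> arcs_ends G = {}" "B \<times> B \<inter> arcs_ends G = {}" "D \<times> D \<inter> arcs_ends G = {}"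
  shows False
proof -
  let ?H = "G \<restriction> (A \<union> B \<union> D)"
  have "A \<noteq> {}" "B \<noteq> {}" using assms(1,2) by auto
  then have sub: "A \<union> B \<union> D \<subseteq> verts G" using adj adj_in_verts by blast
  have adj': "B \<times> A \<subseteq> arcs_ends G" "D \<times> A \<subseteq> arcs_ends G" "D \<times> B \<subseteq> arcs_ends G"
    using adj graph_symmetric by blast+
  have "arcs_ends ?H = A \<times> B \<union> B \<times> A \<union> A \<times> D \<union> D \<times> A \<union> B \<times> D \<union> D \<times> B"
    unfolding arcs_ends_induce
  proof (intro equalityI subrelI)
    fix v w assume vw: "(v, w) \<in> arcs_ends G \<inter> (A \<union> B \<union> D) \<times> (A \<union> B \<union> D)"
    then have "\<not> (v \<in> A \<and> w \<in> A)" "\<not> (v \<in> B \<and> w \<in> B)" "\<not> (v \<in> D \<and> w \<in> D)"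
      using nonadj by auto
    with vw show "(v, w) \<in> A \<times> B \<union> B \<times> A \<union> A \<times> D \<union> D \<times> A \<union> B \<times> D \<union> D \<times> B" by simp blast
  next
    fix v w assume vw: "(v, w) \<in> A \<times> B \<union> B \<times> A \<union> A \<times> D \<union> D \<times> A \<union> B \<times> D \<union> D \<times> B"
    then have "(v, w) \<in> arcs_ends G"
      by (elim UnE) (erule subsetD[OF adj(1)] subsetD[OF adj(2)] subsetD[OF adj(3)]
        subsetD[OF adj'(1)] subsetD[OF adj'(2)] subsetD[OF adj'(3)])+
    then show "(v, w) \<in> arcs_ends G \<inter> (A \<union> B \<union> D) \<times> (A \<union> B \<union> D)" using vw by auto
  qed
  then have "complete_tripartite_digraph 2 2 2 ?H"
    using graph_induce[OF sub] assms(1-6) unfolding complete_tripartite_digraph_def induce_subgraph_verts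
    by blast
  then show False using K222_free induced_induce[OF sub] unfolding K222_free_def by blast
qed

text \<open>Let \<open>a\<close> and \<open>b\<close> be nonadjacent. In a hole with more than four
  vertices, two 4-holes through \<open>a\<close> and \<open>b\<close> share an edge; a hole with
  exactly four vertices forms an octahedron with \<open>a\<close> and \<open>b\<close>.\<close>

lemma common_nbrs_clique:
  assumes "hole_seq d" "a \<in> common_nbrs (set d)" "b \<in> common_nbrs (set d)" "a \<noteq> b"
  shows "a \<rightarrow> b"
proof (rule ccontr)
  assume nonadj: "\<not> a \<rightarrow> b"
  have m: "4 \<le> length d" "distinct d" using assms(1) by (auto simp: hole_seq_def)
  have D: "d ! k \<in> set d" if "k < 4" for k using that m by auto
  have inj: "d ! k = d ! l \<longleftrightarrow> k = l" if "k < 4" "l < 4" for k l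
    using that m by (simp add: nth_eq_iff_index_eq)
  have adj: "d ! k \<rightarrow> a" "d ! k \<rightarrow> b" "a \<rightarrow> d ! k" "b \<rightarrow> d ! k" if "k < 4" for k
    using assms D[OF that] dominates_commute by (auto simp: common_nbrs_def)
  have neq: "d ! k \<noteq> a" "d ! k \<noteq> b" "a \<noteq> d ! k" "b \<noteq> d ! k" if "k < 4" for k
    using assms D[OF that] common_nbrs_disjoint by metis+
  have nonadj02: "\<not> d ! 0 \<rightarrow> d ! 2" "\<not> d ! 2 \<rightarrow> d ! 0"
    using hole_seqD[OF assms(1), of 0 2] m dominates_commute by auto
  have E: "d ! 0 \<rightarrow> d ! 1" "d ! 1 \<rightarrow> d ! 2" "d ! 2 \<rightarrow> d ! 3"
    using hole_seqD[OF assms(1), of 0 1] hole_seqD[OF assms(1), of 1 2] hole_seqD[OF assms(1), of 2 3] m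
    by auto
  show False
  \<comment> \<open>This adjacency holds exactly when the hole has length 4.\<close>
  proof (cases "d ! 0 \<rightarrow> d ! 3")
    case False
    \<comment> \<open>Both 4-holes contain the edge from \<open>a\<close> to \<open>d ! 0\<close>,
      but only the first contains \<open>d ! 2\<close>.\<close>
    have "hole_seq [a, d ! 0, b, d ! 2]" "hole_seq [a, d ! 0, b, d ! 3]"
      by (intro square_hole_seq; use adj neq inj nonadj nonadj02 False assms in auto)+
    from hole_seq_unique[OF hole_edge_disjoint this, of a "d ! 0"]
    have "d ! 2 \<in> {a, d ! 0, b, d ! 3}" using adj by auto
    then show False using neq[of 2] inj[of 2 0] inj[of 2 3] by auto
  next
    case True
    have nonadj13: "\<not> d ! 1 \<rightarrow> d ! 3" using hole_seqD[OF assms(1), of 1 3] m by auto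
    note sym = iffD1[OF dominates_commute]
    note neqs = inj[of 0 1] inj[of 0 2] inj[of 0 3] inj[of 1 2] inj[of 1 3] inj[of 2 3]
      neq[of 0] neq[of 1] neq[of 2] neq[of 3]
    show False
    proof (rule no_octahedron[of "{d ! 0, d ! 2}" "{d ! 1, d ! 3}" "{a, b}"])
      show "card {d ! 0, d ! 2} = 2" "card {d ! 1, d ! 3} = 2" "card {a, b} = 2"
        using neqs \<open>a \<noteq> b\<close> by simp_all
      show "{d ! 0, d ! 2} \<inter> {d ! 1, d ! 3} = {}" "{d ! 0, d ! 2} \<inter> {a, b} = {}"
        "{d ! 1, d ! 3} \<inter> {a, b} = {}"
        using neqs by simp_all
      show "{d ! 0, d ! 2} \<times> {d ! 1, d ! 3} \<subseteq> arcs_ends G" using E True sym[OF E(2)] by simp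
      show "{d ! 0, d ! 2} \<times> {a, b} \<subseteq> arcs_ends G" using adj[of 0] adj[of 2] by simp
      show "{d ! 1, d ! 3} \<times> {a, b} \<subseteq> arcs_ends G" using adj[of 1] adj[of 3] by simp
      show "{d ! 0, d ! 2} \<times> {d ! 0, d ! 2} \<inter> arcs_ends G = {}"
        using nonadj02 not_dominates_self by blast
      show "{d ! 1, d ! 3} \<times> {d ! 1, d ! 3} \<inter> arcs_ends G = {}"
        using nonadj13 not_dominates_self graph_symmetric by blast
      show "{a, b} \<times> {a, b} \<inter> arcs_ends G = {}"
        using nonadj not_dominates_self graph_symmetric by blast
    qed
  qed
qed

end

section \<open>Descent\<close>

context graph
begin

text \<open>For a hole with vertex set \<open>C\<close>, these are the paper's \<open>T\<^bsub>C,xy\<^esub>\<close> and \<open>U\<^bsub>C,xy\<^esub>\<close>.\<close>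

definition apexes :: "'a set \<Rightarrow> 'a \<Rightarrow> 'a \<Rightarrow> 'a set" where
  "apexes C x y = {t \<in> verts G - (C \<union> common_nbrs C). x \<rightarrow> t \<and> y \<rightarrow> t}"

definition flap :: "'a set \<Rightarrow> 'a \<Rightarrow> 'a \<Rightarrow> 'a set" where
  "flap C x y = {z. \<exists>t\<in>apexes C x y. reach (verts G - (C \<union> common_nbrs C)) t z}"

lemma flap_subset: "flap C x y \<subseteq> verts G - (C \<union> common_nbrs C)"
  unfolding flap_def using reach_mem by blast

end

context hed_graph
begin

text \<open>A walk from the apex \<open>t\<close> to \<open>z\<close> is attached to
  \<open>x\<close>, \<open>y\<close> and \<open>c\<close>. Attachments are pairwise equal or
  adjacent, so a third one would close a triangle in the hole.\<close>

lemma flap_attachment: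
  assumes "hole_seq d" "x \<in> set d" "y \<in> set d" "x \<rightarrow> y" "t \<in> apexes (set d) x y"
    and "reach (verts G - (set d \<union> common_nbrs (set d))) t z" "c \<in> set d" "z \<rightarrow> c"
  shows "c = x \<or> c = y"
proof (rule ccontr)
  assume neq: "\<not> (c = x \<or> c = y)"
  obtain p where p: "p \<noteq> []" "hd p = t" "last p = z" "set p \<subseteq> verts G - (set d \<union> common_nbrs (set d))"
    "successively (dominates G) p"
    using reach_walk[OF assms(6)] by blast
  have tz: "t \<in> set p" "z \<in> set p" using p(1-3) by auto
  have t: "x \<rightarrow> t" "y \<rightarrow> t" using assms(5) by (auto simp: apexes_def)
  have disj: "set p \<inter> (set d \<union> common_nbrs (set d)) = {}" using p(4) by blast
  have "c \<rightarrow> z" using assms(8) graph_symmetric by blast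
  then have "x \<rightarrow> c" "y \<rightarrow> c"
    using walk_attachments_clique[OF assms(1) p(5) disj] assms(2,3,7) tz t neq by blast+
  then show False using hole_seq_no_triangle[OF assms(1-3,7,4)] by blast
qed

lemma edge_cut_clique:
  assumes "hole_seq d" "x \<in> set d" "y \<in> set d" "x \<rightarrow> y"
    and "a \<in> common_nbrs (set d) \<union> {x, y}" "b \<in> common_nbrs (set d) \<union> {x, y}" "a \<noteq> b"
  shows "a \<rightarrow> b"
proof -
  have "x \<rightarrow> c \<and> y \<rightarrow> c \<and> c \<rightarrow> x \<and> c \<rightarrow> y" if "c \<in> common_nbrs (set d)" for c
    using that assms(2,3) graph_symmetric unfolding common_nbrs_def by blast
  then show ?thesis
    using assms(4-) graph_symmetric common_nbrs_clique[OF assms(1)] by blast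
qed

text \<open>A step from the flap onto the hole can only hit the ends of the edge, and a step to a
  vertex outside the hole and its common neighbours stays in the same component. So the flap is a
  union of components of \<open>G\<close> minus the cut.\<close>

lemma flap_neighbour:
  assumes "hole_seq d" "x \<in> set d" "y \<in> set d" "x \<rightarrow> y" "z \<in> flap (set d) x y" "z \<rightarrow> w"
  shows "w \<in> flap (set d) x y \<union> (common_nbrs (set d) \<union> {x, y})"
proof -
  obtain t where t: "t \<in> apexes (set d) x y" "reach (verts G - (set d \<union> common_nbrs (set d))) t z"
    using assms(5) by (auto simp: flap_def)
  have "w \<in> verts G" using assms(6) adj_in_verts by blast
  then consider "w \<in> set d" | "w \<in> common_nbrs (set d)" | "w \<in> verts G - (set d \<union> common_nbrs (set d))"
    by blast
  then show ?thesis
  proof cases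
    case 1
    then show ?thesis using flap_attachment[OF assms(1-4) t _ assms(6)] by blast
  next
    case 3
    then show ?thesis using reach_step[OF t(2) assms(6)] t(1) by (auto simp: flap_def)
  qed blast
qed

text \<open>It suffices to find an edge of \<open>f\<close> that starts in the old flap and whose
  own flap avoids the clique \<open>Y\<close>. If \<open>f\<close> meets \<open>Y\<close> in
  \<open>c\<close>, the edge following a neighbour of \<open>c\<close> works; otherwise one of two
  disjoint edges does.\<close>

lemma smaller_flap:
  assumes d: "hole_seq d" "x \<in> set d" "y \<in> set d" "x \<rightarrow> y"
    and f: "hole_seq f" "set f \<subseteq> flap (set d) x y \<union> (common_nbrs (set d) \<union> {x, y})"
  obtains x' y' where "x' \<in> set f" "y' \<in> set f" "x' \<rightarrow> y'" "flap (set f) x' y' \<subset> flap (set d) x y"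
proof -
  note result = that
  define U where "U = flap (set d) x y"
  define Y where "Y = common_nbrs (set d) \<union> {x, y}"
  define S where "S = verts G - (set f \<union> common_nbrs (set f))"
  have clique: "a \<rightarrow> b" if "a \<in> Y" "b \<in> Y" "a \<noteq> b" for a b
    using edge_cut_clique[OF d] that unfolding Y_def by blast
  have nbr: "w \<in> U \<union> Y" if "z \<in> U" "z \<rightarrow> w" for z w
    using flap_neighbour[OF d] that unfolding U_def Y_def by blast
  have sub: "set f \<subseteq> U \<union> Y" using f(2) unfolding U_def Y_def .
  have m: "4 \<le> length f" using f(1) by (simp add: hole_seq_def)
  \<comment> \<open>The new flap grows from neighbours of \<open>x'\<close> and could leave the old
    one only through \<open>Y\<close>; it is strictly smaller because it lacks
    \<open>x'\<close>.\<close>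
  have conclude: thesis if xy': "x' \<in> set f" "y' \<in> set f" "x' \<rightarrow> y'" "x' \<in> U"
    and avoid: "\<And>t z. t \<in> apexes (set f) x' y' \<Longrightarrow> reach S t z \<Longrightarrow> z \<notin> Y" for x' y'
  proof (rule result[OF xy'(1-3)])
    have "z \<in> U" if t: "t \<in> apexes (set f) x' y'" and "reach S t z" for t z
      using that(2)
    proof (induct rule: reach_induct)
      case base
      then have "t \<notin> Y" using avoid[OF t reach_refl] by blast
      moreover have "x' \<rightarrow> t" using t by (simp add: apexes_def)
      ultimately show ?case using nbr xy'(4) by blast
    next
      case (step v w)
      then have "w \<notin> Y" using avoid[OF t reach_step] by blast
      then show ?case using nbr step by blast
    qed
    then have "flap (set f) x' y' \<subseteq> U" by (auto simp: flap_def S_def)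
    moreover have "x' \<notin> flap (set f) x' y'" using flap_subset xy'(1) by blast
    ultimately show "flap (set f) x' y' \<subset> flap (set d) x y" using xy'(4) unfolding U_def by blast
  qed
  show thesis
  proof (cases "set f \<inter> Y = {}")
    case False
    then obtain c where c: "c \<in> set f" "c \<in> Y" by blast
    then obtain k where "k < length f" "f ! k = c" by (metis in_set_conv_nth)
    define g where "g = rotate k f"
    have g: "hole_seq g" "set g = set f" "4 \<le> length g" "distinct g"
      using hole_seq_rotate[OF f(1)] f(1) m by (auto simp: g_def hole_seq_def)
    have "g ! 0 = c" unfolding g_def
      using \<open>k < length f\<close> \<open>f ! k = c\<close> by (subst nth_rotate) (linarith, simp)
    have inj: "g ! k = g ! l \<longleftrightarrow> k = l" if "k < 4" "l < 4" for k l
      using that g(3,4) by (simp add: nth_eq_iff_index_eq)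
    have "\<not> g ! 0 \<rightarrow> g ! 2" "g ! 1 \<rightarrow> g ! 2"
      using hole_seqD[OF g(1), of 0 2] hole_seqD[OF g(1), of 1 2] g(3) by auto
    then have neq: "c \<noteq> g ! 1" "c \<noteq> g ! 2" "\<not> c \<rightarrow> g ! 2" "g ! 2 \<rightarrow> g ! 1"
      using inj[of 0 1] inj[of 0 2] graph_symmetric unfolding \<open>g ! 0 = c\<close> by auto
    have mem: "g ! 1 \<in> set f" "g ! 2 \<in> set f" using g(3) unfolding g(2)[symmetric] by (auto intro!: nth_mem)
    have "g ! 2 \<notin> Y" using clique[OF c(2), of "g ! 2"] neq by blast
    then have "g ! 2 \<in> U" using mem sub by blast
    show thesis
    proof (rule conclude[OF mem(2,1) neq(4) \<open>g ! 2 \<in> U\<close>])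
      fix t z assume t: "t \<in> apexes (set f) (g ! 2) (g ! 1)" "reach S t z"
      \<comment> \<open>A flap meeting the clique \<open>Y\<close> would be attached to
        \<open>c\<close>, which is not an end of the edge.\<close>
      show "z \<notin> Y"
      proof
        assume "z \<in> Y"
        have "z \<noteq> c" using reach_mem[OF t(2)] c(1) unfolding S_def by blast
        then have "z \<rightarrow> c" using clique[OF \<open>z \<in> Y\<close> c(2)] by blast
        then show False
          using flap_attachment[OF f(1) mem(2,1) neq(4) t(1) t(2)[unfolded S_def] c(1)] neq by blast
      qed
    qed
  next
    case True
    then have fU: "set f \<subseteq> U" using sub by blast
    have mem: "f ! 0 \<in> set f" "f ! 1 \<in> set f" "f ! 2 \<in> set f" "f ! 3 \<in> set f"
      using m by (auto intro!: nth_mem)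
    have E: "f ! 0 \<rightarrow> f ! 1" "f ! 2 \<rightarrow> f ! 3"
      using hole_seqD[OF f(1), of 0 1] hole_seqD[OF f(1), of 2 3] m by auto
    have inj: "f ! k = f ! l \<longleftrightarrow> k = l" if "k < 4" "l < 4" for k l
      using that f(1) m by (simp add: nth_eq_iff_index_eq hole_seq_def)
    have "f ! 2 \<noteq> f ! 0" "f ! 2 \<noteq> f ! 1" using inj[of 2 0] inj[of 2 1] by auto
    show thesis
    \<comment> \<open>If the flaps of both edges met \<open>Y\<close>, the clique would link them,
      and \<open>f ! 2\<close> would be an attachment of the flap of the first edge.\<close>
    proof (cases "\<exists>t z. t \<in> apexes (set f) (f ! 0) (f ! 1) \<and> reach S t z \<and> z \<in> Y")
      case False
      then show thesis using conclude[OF mem(1,2) E(1)] fU mem(1) by blast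
    next
      case True
      then obtain t z where t: "t \<in> apexes (set f) (f ! 0) (f ! 1)" "reach S t z" "z \<in> Y" by blast
      show thesis
      proof (rule conclude[OF mem(3,4) E(2)])
        show "f ! 2 \<in> U" using fU mem(3) by blast
        fix t' z' assume t': "t' \<in> apexes (set f) (f ! 2) (f ! 3)" "reach S t' z'"
        show "z' \<notin> Y"
        proof
          assume "z' \<in> Y"
          have "z \<in> S" "z' \<in> S" using reach_mem t(2) t'(2) by blast+
          then have "reach S z z'"
            using clique[OF t(3) \<open>z' \<in> Y\<close>] by (cases "z = z'") (auto intro: reach_refl reach_adj)
          then have "reach S t t'" using t(2) t'(2) by (blast intro: reach_trans reach_sym)
          moreover have "t' \<rightarrow> f ! 2" using t'(1) graph_symmetric by (auto simp: apexes_def)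
          ultimately show False
            using flap_attachment[OF f(1) mem(1,2) E(1) t(1) _ mem(3)] \<open>f ! 2 \<noteq> f ! 0\<close> \<open>f ! 2 \<noteq> f ! 1\<close>
            unfolding S_def by blast
        qed
      qed
    qed
  qed
qed

lemma ex_flap_without_hole:
  assumes "hole_seq d" "x \<in> set d" "y \<in> set d" "x \<rightarrow> y"
  shows "\<exists>d x y. hole_seq d \<and> x \<in> set d \<and> y \<in> set d \<and> x \<rightarrow> y \<and>
    (\<forall>f. hole_seq f \<longrightarrow> \<not> set f \<subseteq> flap (set d) x y \<union> (common_nbrs (set d) \<union> {x, y}))"
  using assms
proof (induct "card (flap (set d) x y)" arbitrary: d x y rule: less_induct)
  case less
  show ?case
  proof (cases "\<exists>f. hole_seq f \<and> set f \<subseteq> flap (set d) x y \<union> (common_nbrs (set d) \<union> {x, y})")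
    case True
    then obtain f where f: "hole_seq f" "set f \<subseteq> flap (set d) x y \<union> (common_nbrs (set d) \<union> {x, y})"
      by blast
    obtain x' y' where xy': "x' \<in> set f" "y' \<in> set f" "x' \<rightarrow> y'" "flap (set f) x' y' \<subset> flap (set d) x y"
      using smaller_flap[OF less.prems f] by blast
    have "finite (flap (set d) x y)" using flap_subset finite_verts by (meson Diff_subset finite_subset)
    then have "card (flap (set f) x' y') < card (flap (set d) x y)"
      using xy'(4) by (rule psubset_card_mono)
    then show ?thesis using less.hyps f(1) xy'(1-3) by blast
  next
    case False
    then show ?thesis using less.prems by blast
  qed
qed

end

section \<open>Components and clique cuts\<close>

context graph
begin

definition component :: "'a set \<Rightarrow> 'a \<Rightarrow> 'a set" where
  "component S a = {b. reach S a b}"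

lemma component_eq: "reach S a b \<Longrightarrow> component S a = component S b"
  unfolding component_def by (blast intro: reach_trans reach_sym)

lemma reach_component: "reach S a b \<Longrightarrow> reach (component S a) a b"
proof (induct rule: reach_induct)
  case base
  then show ?case by (auto intro: reach_refl simp: component_def)
next
  case (step y z)
  then show ?case by (auto intro: reach_step simp: component_def)
qed

lemma reachable_induce_iff: "a \<rightarrow>\<^sup>*\<^bsub>G \<restriction> S\<^esub> b \<longleftrightarrow> reach S a b"
proof
  assume "a \<rightarrow>\<^sup>*\<^bsub>G \<restriction> S\<^esub> b"
  then show "reach S a b"
    unfolding reachable_def
    by (induct rule: rtrancl_on_induct) (auto simp: arcs_ends_induce intro: reach_refl reach_step)
next
  assume "reach S a b"
  then show "a \<rightarrow>\<^sup>*\<^bsub>G \<restriction> S\<^esub> b"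
  proof (induct rule: reach_induct)
    case base
    then show ?case by (simp add: reachable_def)
  next
    case (step y z)
    then have "y \<in> S" using reach_mem by blast
    with step show ?case
      unfolding reachable_def by (auto intro!: rtrancl_on_into_rtrancl_on[of a y] simp: arcs_ends_induce)
  qed
qed

lemma components_induce: "components (G \<restriction> S) = component S ` S"
proof (intro set_eqI iffI)
  fix K assume "K \<in> components (G \<restriction> S)"
  then have K: "K \<noteq> {}" "\<And>a b. a \<in> K \<Longrightarrow> b \<in> K \<Longrightarrow> reach S a b"
    "\<And>a b. a \<in> K \<Longrightarrow> b \<notin> K \<Longrightarrow> \<not> reach S a b \<or> \<not> reach S b a"
    unfolding pre_digraph.sccs_verts_def reachable_induce_iff by blast+
  then obtain a where "a \<in> K" by blast
  with K have "a \<in> S" "K = component S a"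
    unfolding component_def using reach_mem reach_sym by blast+
  then show "K \<in> component S ` S" by blast
next
  fix K assume "K \<in> component S ` S"
  then obtain a where a: "a \<in> S" "K = component S a" by blast
  then have "a \<in> K" by (simp add: component_def reach_refl)
  moreover have "reach S b c" if "b \<in> K" "c \<in> K" for b c
    using that a unfolding component_def by (blast intro: reach_trans reach_sym)
  moreover have "\<not> reach S b c" if "b \<in> K" "c \<notin> K" for b c
    using that a unfolding component_def by (blast intro: reach_trans)
  ultimately show "K \<in> components (G \<restriction> S)"
    unfolding pre_digraph.sccs_verts_def reachable_induce_iff by blast
qed

lemma components_conv: "components G = component (verts G) ` verts G"
proof -
  have "G \<restriction> verts G = G" by (intro pre_digraph.equality) auto
  then show ?thesis using components_induce[of "verts G"] by simp
qed

lemma components_del_verts: "components (del_verts G X) = component (verts G - X) ` (verts G - X)"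
  unfolding del_verts_def by (rule components_induce)

text \<open>Sending each component of \<open>G - X\<close> to the component of \<open>G\<close>
  around it is onto, since every vertex of the clique is connected to \<open>s\<close> through
  \<open>u\<close>. It merges the components of \<open>s\<close> and \<open>t\<close>, so deleting
  \<open>X\<close> increases the number.\<close>

lemma clique_cutI:
  assumes "X \<subseteq> verts G" "\<And>a b. a \<in> X \<Longrightarrow> b \<in> X \<Longrightarrow> a \<noteq> b \<Longrightarrow> a \<rightarrow> b"
    and "u \<in> X" "u \<rightarrow> s" "u \<rightarrow> t" "s \<notin> X" "t \<notin> X" "\<not> reach (verts G - X) s t"
  shows "clique_cut G X"
proof -
  let ?S = "verts G - X"
  have st: "s \<in> ?S" "t \<in> ?S" "u \<in> verts G" using assms adj_in_verts by blast+
  define \<phi> where "\<phi> K = (\<Union>a\<in>K. component (verts G) a)" for K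
  have phi: "\<phi> (component ?S a) = component (verts G) a" if "a \<in> ?S" for a
  proof -
    have "component (verts G) b = component (verts G) a" if "b \<in> component ?S a" for b
      using that by (intro component_eq[symmetric]) (auto simp: component_def intro: reach_mono)
    moreover have "a \<in> component ?S a" using that by (auto simp: component_def reach_refl)
    ultimately show ?thesis unfolding \<phi>_def by blast
  qed
  have us: "component (verts G) u = component (verts G) s" "component (verts G) u = component (verts G) t"
    using assms(4,5) st by (auto intro!: component_eq reach_adj)
  have "components G = \<phi> ` components (del_verts G X)"
  proof -
    have "component (verts G) a \<in> \<phi> ` component ?S ` ?S" if "a \<in> verts G" for a
    proof (cases "a \<in> X")
      case True
      then have "reach (verts G) a u"
        using assms(2)[OF True assms(3)] st that by (cases "a = u") (auto intro: reach_refl reach_adj)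
      then have "component (verts G) a = \<phi> (component ?S s)"
        using component_eq us(1) phi[OF st(1)] by metis
      then show ?thesis using st(1) by blast
    next
      case False
      then show ?thesis using phi[of a] that by (metis DiffI imageI)
    qed
    moreover have "\<phi> (component ?S a) \<in> component (verts G) ` verts G" if "a \<in> ?S" for a
      using phi[OF that] that by blast
    ultimately show ?thesis unfolding components_conv components_del_verts by blast
  qed
  moreover have "finite (components (del_verts G X))" unfolding components_del_verts by simp
  moreover have "\<not> inj_on \<phi> (components (del_verts G X))"
  proof
    assume "inj_on \<phi> (components (del_verts G X))"
    moreover have "\<phi> (component ?S s) = \<phi> (component ?S t)" using phi st us by simp
    ultimately have "component ?S s = component ?S t"
      using st unfolding components_del_verts by (meson imageI inj_onD)
    moreover have "t \<in> component ?S t" using st by (simp add: component_def reach_refl)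
    ultimately show False using assms(8) by (auto simp: component_def)
  qed
  ultimately have "card (components G) < card (components (del_verts G X))"
    by (metis card_image_le inj_on_iff_eq_card le_neq_implies_less)
  moreover have "complete_digraph (card X) (G \<restriction> X)"
    unfolding complete_digraph_def arcs_ends_induce
    using graph_induce[OF assms(1)] assms(2) not_dominates_self by auto
  ultimately show ?thesis using assms(1) unfolding clique_cut_def by blast
qed

text \<open>A chord in \<open>G\<close> of a hole of \<open>G \<restriction> S\<close> would already
  be present in \<open>G \<restriction> S\<close>, so such a hole is a hole of
  \<open>G\<close>.\<close>

lemma chordal_induceI:
  assumes "S \<subseteq> verts G" "\<And>f. hole_seq f \<Longrightarrow> \<not> set f \<subseteq> S"
  shows "chordal (G \<restriction> S)"
  unfolding chordal_def
proof
  assume "\<exists>D. is_hole (G \<restriction> S) D"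
  then obtain D where D: "is_hole (G \<restriction> S) D" by blast
  then have sub: "verts D \<subseteq> S" by (auto simp: is_hole_def subgraph_def)
  have "subgraph D G"
    using D assms(1) wf_digraph by (auto simp: is_hole_def subgraph_def compatible_def)
  moreover have "chordless G D"
    using D sub unfolding is_hole_def chordless_def arcs_ends_induce by blast
  ultimately have "is_hole G D" using D by (simp add: is_hole_def)
  then obtain f where "hole_seq f" "D = G \<restriction> set f" using is_hole_obtain_seq by blast
  then show False using assms(2) sub by auto
qed

section \<open>The sets \<open>T_edge\<close>, \<open>S_edge\<close> and \<open>U_edge\<close> in
  terms of apexes and flaps\<close>

lemma vwalk_iff: "vwalk p G \<longleftrightarrow> p \<noteq> [] \<and> set p \<subseteq> verts G \<and> successively (dominates G) p"
proof -
  have "set (vwalk_arcs p) \<subseteq> arcs_ends G \<longleftrightarrow> successively (dominates G) p"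
    by (induct p rule: vwalk_arcs.induct) auto
  then show ?thesis by (auto simp: vwalk_def)
qed

lemma T_edge_eq:
  assumes "u \<rightarrow> v" "u \<in> verts C" "v \<in> verts C"
  shows "T_edge G C u v = apexes (verts C) u v"
proof -
  have X: "X_hole G C = common_nbrs (verts C)" by (simp add: X_hole_def common_nbrs_def)
  have "u \<in> verts G" "v \<in> verts G" "u \<noteq> v" using assms(1) adj_in_verts not_dominates_self by blast+
  then show ?thesis
    unfolding T_edge_def P_edge_def apexes_def vpath_def vwalk_iff avoiding_def X
    using assms(2,3) dominates_commute by auto
qed

end

context hed_graph
begin

text \<open>The interior of a path contributing to \<open>S_edge\<close> is a nonempty detour off
  the hole. With no apex on it, it would have to cover the hole.\<close>

lemma apexes_nonempty:
  assumes "hole_seq d" "verts C = set d" "u \<in> set d" "v \<in> set d" "u \<rightarrow> v" "S_edge G C u v \<noteq> {}"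
  shows "apexes (set d) u v \<noteq> {}"
proof -
  have X: "X_hole G C = common_nbrs (set d)" by (simp add: X_hole_def common_nbrs_def assms(2))
  have "u \<noteq> v" using assms(5) not_dominates_self by blast
  from assms(6) obtain W w where W: "vpath W G" "hd W = u" "last W = v" "avoiding G C W"
    and w: "w \<in> set W" "w \<noteq> u" "w \<noteq> v"
    unfolding S_edge_def P_edge_def by blast
  define P where "P = butlast (tl W)"
  have "W \<noteq> []" using w by auto
  then have "W = u # tl W" using W(2) by (cases W) auto
  moreover from this have "tl W \<noteq> []" using w by (metis empty_iff empty_set set_ConsD)
  moreover from calculation have "last (tl W) = v" using W(3) by (metis last_ConsR)
  ultimately have W_eq: "W = u # P @ [v]" unfolding P_def by (metis append_butlast_last_id)
  then have "P \<noteq> []" using w by auto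
  have disj: "set P \<inter> (set d \<union> common_nbrs (set d)) = {}"
    using W(4) unfolding avoiding_def X assms(2) P_def by blast
  have "successively (dominates G) (u # P @ [v])" "set P \<subseteq> verts G"
    using W(1) W_eq unfolding vpath_def vwalk_iff by auto
  then have walk: "successively (dominates G) P" "u \<rightarrow> hd P" "v \<rightarrow> last P"
    using \<open>P \<noteq> []\<close> dominates_commute by (auto simp: successively_Cons successively_append_iff)
  have "\<exists>t\<in>set P. u \<rightarrow> t \<and> v \<rightarrow> t"
  proof (rule ccontr)
    assume none: "\<not> ?thesis"
    have "set d \<subseteq> insert u (insert v (set P))"
    proof (rule detour_covers_hole[OF assms(1,3-5)])
      show "reach (set P) (hd P) (last P)" using walk_reach[OF walk(1)] \<open>P \<noteq> []\<close> by simp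
    qed (use disj assms walk none in auto)
    then have "set d \<subseteq> {u, v}" using disj by blast
    then have "card (set d) \<le> card {u, v}" by (intro card_mono) auto
    then show False using assms(1) \<open>u \<noteq> v\<close> by (auto simp: hole_seq_def distinct_card)
  qed
  then show ?thesis using disj \<open>set P \<subseteq> verts G\<close> unfolding apexes_def by blast
qed

text \<open>The larger set adds only the rest of the hole, and by \<open>flap_attachment\<close>
  none of it is adjacent to a vertex connected to \<open>t\<close>.\<close>

lemma component_apex:
  assumes d: "hole_seq d" "x \<in> set d" "y \<in> set d" "x \<rightarrow> y" and t: "t \<in> apexes (set d) x y"
  shows "component (verts G - (common_nbrs (set d) \<union> {x, y})) t =
    component (verts G - (set d \<union> common_nbrs (set d))) t" (is "component ?S t = component ?S' t")
proof
  show "component ?S' t \<subseteq> component ?S t"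
    using reach_mono[of ?S' t _ ?S] d(2,3) unfolding component_def by blast
  have "z \<in> component ?S' t" if "reach ?S t z" for z
    using that
  proof (rule reach_closed)
    show "t \<in> component ?S' t" using t by (auto simp: component_def apexes_def intro: reach_refl)
    fix a b assume a: "a \<in> component ?S' t" "a \<rightarrow> b" "b \<in> ?S"
    then have "b \<notin> set d" using flap_attachment[OF d t, of a b] by (auto simp: component_def)
    then show "b \<in> component ?S' t" using a reach_step[of ?S' t a b] by (auto simp: component_def)
  qed
  then show "component ?S t \<subseteq> component ?S' t" by (auto simp: component_def)
qed

text \<open>Deleting the component \<open>Q\<close> of the rest of the hole leaves the components of
  the apexes intact, so both sides collect the same components.\<close>

lemma U_edge_eq:
  assumes d: "hole_seq d" "x \<in> set d" "y \<in> set d" "x \<rightarrow> y" and C: "verts C = set d"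
  shows "U_edge G C x y = flap (set d) x y"
proof -
  define Y where "Y = common_nbrs (set d) \<union> {x, y}"
  define S where "S = verts G - Y"
  have X: "X_edge G C x y = Y" by (simp add: X_edge_def X_hole_def Y_def common_nbrs_def C)
  \<comment> \<open>With \<open>xy\<close> as closing edge, the rest of the hole is the connected
    segment of indices 1 to \<open>n - 1\<close>; \<open>f ! 1\<close> will represent it.\<close>
  obtain f where f: "hole_seq f" "set f = set d" "hd f = x" "last f = y"
    using hole_seq_edge d by metis
  define n where "n = length f - 1"
  have "4 \<le> length f" "distinct f" using f(1) by (simp_all add: hole_seq_def)
  then have n: "3 \<le> n" "length f = Suc n" "distinct f" "f \<noteq> []" by (auto simp: n_def)
  have ends: "f ! 0 = x" "f ! n = y"
    using hd_conv_nth[OF n(4)] last_conv_nth[OF n(4)] f(3,4) by (simp_all add: n(2))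
  have inner: "(!) f ` {1..n - 1} = set d - {x, y}"
  proof -
    have "set f = (!) f ` {0..n}" unfolding set_conv_nth n(2) by (auto simp: less_Suc_eq_le)
    then have "set d = (!) f ` {0..n}" using f(2) by simp
    also have "{0..n} = insert 0 (insert n {1..n - 1})" using n by auto
    finally have "set d = insert x (insert y ((!) f ` {1..n - 1}))" using ends by simp
    moreover have "x \<notin> (!) f ` {1..n - 1}" "y \<notin> (!) f ` {1..n - 1}"
      using n nth_eq_iff_index_eq[OF n(3)] unfolding ends[symmetric] by auto
    ultimately show ?thesis by blast
  qed
  have inS: "set d - {x, y} \<subseteq> S"
    using hole_seq_verts[OF d(1)] common_nbrs_disjoint[of _ "set d"] unfolding S_def Y_def by blast
  have conn: "reach S (f ! 1) c" if c: "c \<in> set d - {x, y}" for c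
  proof -
    have "c \<in> (!) f ` {1..n - 1}" using c inner by blast
    then obtain k where k: "c = f ! k" "1 \<le> k" "k \<le> n - 1" by auto
    then have "reach ((!) f ` {1..k}) (f ! 1) c"
      using hole_seq_segment_reach[OF f(1), of 1 k] n by simp
    moreover have "(!) f ` {1..k} \<subseteq> (!) f ` {1..n - 1}" using k by auto
    then have "(!) f ` {1..k} \<subseteq> S" using inner inS by blast
    ultimately show ?thesis by (rule reach_mono)
  qed
  define Q where "Q = component S (f ! 1)"
  have f1: "f ! 1 \<in> set d - {x, y}" unfolding inner[symmetric] using n(1) by (intro imageI) simp
  have Q: "Q_edge G C x y = Q"
    unfolding Q_edge_def X
  proof (rule the_equality)
    show "Q \<in> components (del_verts G Y) \<and> verts C - {x, y} \<subseteq> Q"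
      using conn f1 inS unfolding components_del_verts Q_def C S_def component_def by blast
    fix K assume K: "K \<in> components (del_verts G Y) \<and> verts C - {x, y} \<subseteq> K"
    then obtain a where "K = component S a" unfolding components_del_verts S_def by blast
    moreover from this have "reach S a (f ! 1)" using K f1 unfolding C component_def by blast
    ultimately show "K = Q" unfolding Q_def using component_eq by blast
  qed
  have del: "del_verts (del_verts G Y) Q = G \<restriction> (S - Q)"
    unfolding del_verts_def S_def by (auto simp: induce_subgraph_def)
  let ?S' = "verts G - (set d \<union> common_nbrs (set d))"
  have comp: "component (S - Q) t = component ?S' t" and tSQ: "t \<in> S - Q"
    if t: "t \<in> apexes (set d) x y" for t
  proof -
    have eq: "component S t = component ?S' t" using component_apex[OF d t] unfolding S_def Y_def .
    have t': "t \<in> ?S'" "t \<in> S" using t d by (auto simp: apexes_def S_def Y_def)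
    \<comment> \<open>The component of an apex lies off the hole and so differs from
      \<open>Q\<close>.\<close>
    have "\<not> reach S t (f ! 1)"
    proof
      assume "reach S t (f ! 1)"
      then have "reach ?S' t (f ! 1)" using eq by (auto simp: component_def)
      then show False using reach_mem f1 by blast
    qed
    then have disj: "component S t \<inter> Q = {}"
      unfolding Q_def component_def by (blast intro: reach_trans reach_sym)
    have "component S t \<subseteq> S - Q" using disj reach_mem unfolding component_def by blast
    then have "component S t \<subseteq> component (S - Q) t"
      using reach_component reach_mono unfolding component_def by blast
    moreover have "component (S - Q) t \<subseteq> component S t"
      using reach_mono[of "S - Q" t _ S] unfolding component_def by blast
    ultimately show "component (S - Q) t = component ?S' t" using eq by blast
    show "t \<in> S - Q" using t' disj reach_refl[of t S] unfolding component_def by blast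
  qed
  have T: "T_edge G C x y = apexes (set d) x y" using T_edge_eq[OF d(4)] d(2,3) C by simp
  have "U_edge G C x y = \<Union> {K \<in> component (S - Q) ` (S - Q). K \<inter> apexes (set d) x y \<noteq> {}}"
    unfolding U_edge_def X Q del components_induce T ..
  also have "\<dots> = (\<Union>t\<in>apexes (set d) x y. component (S - Q) t)"
  proof (intro equalityI subsetI)
    fix z assume "z \<in> \<Union> {K \<in> component (S - Q) ` (S - Q). K \<inter> apexes (set d) x y \<noteq> {}}"
    then obtain a t where "z \<in> component (S - Q) a" "t \<in> component (S - Q) a" "t \<in> apexes (set d) x y"
      by blast
    moreover from this have "component (S - Q) a = component (S - Q) t"
      by (intro component_eq) (simp add: component_def)
    ultimately show "z \<in> (\<Union>t\<in>apexes (set d) x y. component (S - Q) t)" by blast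
  next
    fix z assume "z \<in> (\<Union>t\<in>apexes (set d) x y. component (S - Q) t)"
    then obtain t where t: "t \<in> apexes (set d) x y" "z \<in> component (S - Q) t" by blast
    moreover have "t \<in> component (S - Q) t" using tSQ[OF t(1)] by (simp add: component_def reach_refl)
    ultimately show "z \<in> \<Union> {K \<in> component (S - Q) ` (S - Q). K \<inter> apexes (set d) x y \<noteq> {}}"
      using tSQ[OF t(1)] by blast
  qed
  also have "\<dots> = flap (set d) x y" using comp by (auto simp: flap_def component_def)
  finally show ?thesis .
qed

end

section \<open>From a hole-free flap to the chordal cut\<close>

theorem theorem2p1:
  fixes G :: "('a,'b) pre_digraph"
  assumes "graph G"
    and "K222_free G"
    and "hole_edge_disjoint G"
    and "\<exists>C. is_hole G C"
    and "\<And>C u v. is_hole G C \<Longrightarrow> u \<rightarrow>\<^bsub>C\<^esub> v \<Longrightarrow> S_edge G C u v \<noteq> {}"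
  shows "chordal_property G \<and> (\<exists>X. chordal_cut G X)"
proof -
  interpret hed_graph G
    using assms(1-3) by (simp add: hed_graph_def hed_graph_axioms_def)
  \<comment> \<open>The descent starts from the first edge of an arbitrary hole.\<close>
  obtain d0 where d0: "hole_seq d0" using assms(4) is_hole_obtain_seq by blast
  then have "d0 ! 0 \<rightarrow>\<^bsub>G\<^esub> d0 ! 1" "d0 ! 0 \<in> set d0" "d0 ! 1 \<in> set d0"
    using hole_seqD[OF d0, of 0 1] by (auto simp: hole_seq_def intro!: nth_mem)
  then obtain d x y where d: "hole_seq d" "x \<in> set d" "y \<in> set d" "x \<rightarrow>\<^bsub>G\<^esub> y"
    and no_hole: "\<And>f. hole_seq f \<Longrightarrow> \<not> set f \<subseteq> flap (set d) x y \<union> (common_nbrs (set d) \<union> {x, y})"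
    using ex_flap_without_hole[OF d0] by blast
  define C where "C = G \<restriction> set d"
  define Y where "Y = common_nbrs (set d) \<union> {x, y}"
  have C: "is_hole G C" "verts C = set d" "x \<rightarrow>\<^bsub>C\<^esub> y"
    using hole_seq_is_hole[OF d(1)] d(2-4) by (auto simp: C_def arcs_ends_induce)
  have X: "X_edge G C x y = Y" by (simp add: X_edge_def X_hole_def Y_def common_nbrs_def C(2))
  have "Y \<subseteq> verts G" using hole_seq_verts[OF d(1)] d(2,3) by (auto simp: Y_def common_nbrs_def)
  moreover have "flap (set d) x y \<subseteq> verts G" using flap_subset by blast
  ultimately have chordal: "chordal (G \<restriction> (flap (set d) x y \<union> Y))"
    using no_hole unfolding Y_def by (intro chordal_induceI) auto
  then have "chordal_property G"
    using C d U_edge_eq[OF d C(2)] unfolding chordal_property_def X[symmetric] by metis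
  moreover have "chordal_cut G Y"
  proof -
    let ?S = "verts G - Y" and ?T = "apexes (set d) x y"
    \<comment> \<open>Nonemptiness of \<open>S_edge\<close> enters here: the flap has a vertex for
      the cut to separate.\<close>
    obtain t where t: "t \<in> ?T"
      using apexes_nonempty[OF d(1) C(2) d(2-4) assms(5)[OF C(1,3)]] by blast
    have T: "?T \<subseteq> ?S" using d(2,3) by (auto simp: apexes_def Y_def)
    \<comment> \<open>\<open>f ! 1\<close> is the neighbour of \<open>x\<close> on the hole other
      than \<open>y\<close>; the cut separates it from \<open>t\<close>.\<close>
    obtain f where f: "hole_seq f" "set f = set d" "hd f = x" "last f = y"
      using hole_seq_edge d by metis
    then have len: "4 \<le> length f" "distinct f" "f \<noteq> []" by (auto simp: hole_seq_def)
    have f1: "x \<rightarrow>\<^bsub>G\<^esub> f ! 1" "f ! 1 \<in> set d" "f ! 1 \<noteq> x" "f ! 1 \<noteq> y"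
    proof -
      show "x \<rightarrow>\<^bsub>G\<^esub> f ! 1" using hole_seqD[OF f(1), of 0 1] f(3) len by (simp add: hd_conv_nth)
      show "f ! 1 \<in> set d" using f(2) len by (auto intro!: nth_mem)
      show "f ! 1 \<noteq> x" using \<open>x \<rightarrow>\<^bsub>G\<^esub> f ! 1\<close> not_dominates_self by metis
      have "f ! 1 \<noteq> f ! (length f - 1)"
        using len by (subst nth_eq_iff_index_eq) auto
      then show "f ! 1 \<noteq> y" using f(4) len by (simp add: last_conv_nth)
    qed
    have "clique_cut G Y"
    proof (rule clique_cutI[OF \<open>Y \<subseteq> verts G\<close>])
      show "a \<rightarrow>\<^bsub>G\<^esub> b" if "a \<in> Y" "b \<in> Y" "a \<noteq> b" for a b
        using edge_cut_clique[OF d] that unfolding Y_def by blast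
      show "x \<in> Y" by (simp add: Y_def)
      show "x \<rightarrow>\<^bsub>G\<^esub> t" using t by (simp add: apexes_def)
      show "x \<rightarrow>\<^bsub>G\<^esub> f ! 1" by (rule f1)
      show "t \<notin> Y" using T t by blast
      show "f ! 1 \<notin> Y" using f1 common_nbrs_disjoint unfolding Y_def by blast
      show "\<not> reach ?S t (f ! 1)"
      proof
        assume "reach ?S t (f ! 1)"
        then have "reach (verts G - (set d \<union> common_nbrs (set d))) t (f ! 1)"
          using component_apex[OF d t] unfolding Y_def component_def by blast
        then show False using reach_mem f1(2) by blast
      qed
    qed
    \<comment> \<open>The components of the apexes are the required union; there is at least one
      because of \<open>t\<close>, and together they form the flap.\<close>
    moreover have "component ?S ` ?T \<subseteq> components (del_verts G Y)"
      using T unfolding components_del_verts by blast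
    moreover have "\<Union> (component ?S ` ?T) = flap (set d) x y"
      using component_apex[OF d] unfolding Y_def by (auto simp: flap_def component_def)
    ultimately show ?thesis
      using t chordal unfolding chordal_cut_def by (metis empty_iff image_is_empty)
  qed
  ultimately show ?thesis by blast
qed

end
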